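(* Let $k$ be a field of characteristic zero. Let $h=(1,h_1=r,h_2,\dots,h_e)$ be any $h$-vector, and let $s=(0,s_1,\dots,s_e)$ be the maximum socle-vector for $h$, that is, $s_e=h_e$ and $s_i=h_i-((h_{i+1})_{(i+1)})_{-1}^{-1}$ for $i=1,\dots,e-1$. Let $t$ be the largest integer such that $h_t=\binom{r-1+t}{t}$. If any one of the following conditions is verified, then there exists more than one socle-vector associated to $h$ (i.e. there exist two standard graded artinian $k$-algebras with $h$-vector $h$ and different socle-vectors): (i) $s_{t+1}s_{t+2}\neq 0$; (ii) there exists an index $i$ such that $s_is_{i+1}\neq 0$ and $((h_{i+1}+1)_{(i+1)})_{-1}^{-1}>((h_{i+1})_{(i+1)})_{-1}^{-1}$; (iii) $s_{e-1}\neq 0$.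
   Context: Algebras are standard graded artinian $k$-algebras $A=R/I$, with $R=k[x_1,\dots,x_r]$, $k$ a field of characteristic zero, and $I$ a homogeneous ideal containing no non-zero forms of degree 1. The $h$-vector of $A$ is $h(A)=(h_0,h_1,\dots,h_e)$, where $h_i=\dim_k A_i$ and $e\ge 1$ is the last index with $A_e\neq 0$; thus $h_0=1$ and $h_1=r$. The socle of $A$ is $soc(A)=\{a\in A : a\overline{m}=0\}$, where $\overline m=(\overline{x_1},\dots,\overline{x_r})$, and the socle-vector of $A$ is $s(A)=(s_0,s_1,\dots,s_e)$ with $s_i=\dim_k soc(A)_i$; thus $s_0=0$ and $s_e=h_e>0$. "An $h$-vector" means a tuple that is the $h$-vector of some such algebra. Set $h_i=s_i=0$ for $i>e$. The maximum socle-vector for an $h$-vector $h$ is the entry by entry maximum among the socle-vectors of all such algebras having $h$-vector $h$; it exists and is given by the formula in the statement. For positive integers $n,i$, the $i$-binomial expansion of $n$ is the unique expression $n_{(i)}=\binom{n_i}{i}+\binom{n_{i-1}}{i-1}+\dots+\binom{n_j}{j}$ with $n_i>n_{i-1}>\dots>n_j\ge j\ge 1$. For an integer $a$, $(n_{(i)})_a^a=\binom{n_i+a}{i+a}+\binom{n_{i-1}+a}{i-1+a}+\dots+\binom{n_j+a}{j+a}$ (with $\binom{m}{0}=1$ for $m\ge 0$). *)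

theory Defs
  imports "HOL-Library.Poly_Mapping" "HOL-Algebra.QuotRing" "HOL-Algebra.Embedded_Algebras"
begin

text \<open>
  Polynomials over \<open>'k\<close> are finitely supported maps from exponent vectors to coefficients. The
  ring \<open>k[x\<^sub>1, \<dots>, x\<^sub>r]\<close> consists of those in which only the variables with index below \<open>r\<close>
  occur, so the variables are numbered from \<open>0\<close>.
\<close>

type_synonym 'k mpolynomial = "(nat \<Rightarrow>\<^sub>0 nat) \<Rightarrow>\<^sub>0 'k"

definition poly_ring :: "nat \<Rightarrow> 'k::field mpolynomial ring" where
  "poly_ring r =
    \<lparr>carrier = {p. \<forall>m\<in>Poly_Mapping.keys p. Poly_Mapping.keys m \<subseteq> {..<r}},
     monoid.mult = (*), one = 1, zero = 0, add = (+)\<rparr>"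

definition const_poly :: "'k::field \<Rightarrow> 'k mpolynomial" where
  "const_poly c = Poly_Mapping.single 0 c"

definition var_poly :: "nat \<Rightarrow> 'k::field mpolynomial" where
  "var_poly j = Poly_Mapping.single (Poly_Mapping.single j 1) 1"

definition monomial_degree :: "(nat \<Rightarrow>\<^sub>0 nat) \<Rightarrow> nat" where
  "monomial_degree m = (\<Sum>j\<in>Poly_Mapping.keys m. Poly_Mapping.lookup m j)"

definition forms :: "nat \<Rightarrow> nat \<Rightarrow> 'k::field mpolynomial set" where
  "forms r d = {p \<in> carrier (poly_ring r). \<forall>m\<in>Poly_Mapping.keys p. monomial_degree m = d}"

definition homogeneous_component :: "nat \<Rightarrow> 'k::field mpolynomial \<Rightarrow> 'k mpolynomial" where
  "homogeneous_component d p =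
    (\<Sum>m\<in>{m \<in> Poly_Mapping.keys p. monomial_degree m = d}.
      Poly_Mapping.single m (Poly_Mapping.lookup p m))"

definition homogeneous_ideal :: "nat \<Rightarrow> 'k::field mpolynomial set \<Rightarrow> bool" where
  "homogeneous_ideal r I \<longleftrightarrow>
    ideal I (poly_ring r) \<and> (\<forall>p\<in>I. \<forall>d. homogeneous_component d p \<in> I)"

lemma poly_ring_cring: "cring (poly_ring r :: 'k::field mpolynomial ring)"
proof (rule cringI)
  have closed_add: "p + q \<in> carrier (poly_ring r)"
    if "p \<in> carrier (poly_ring r)" "q \<in> carrier (poly_ring r)" for p q :: "'k mpolynomial"
    using that keys_add[of p q] unfolding poly_ring_def by auto
  have closed_mult: "p * q \<in> carrier (poly_ring r)"
    if p: "p \<in> carrier (poly_ring r)" and q: "q \<in> carrier (poly_ring r)"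
    for p q :: "'k mpolynomial"
  proof -
    have "Poly_Mapping.keys m \<subseteq> {..<r}" if "m \<in> Poly_Mapping.keys (p * q)" for m
    proof -
      from that obtain a b where m: "m = a + b" and ab: "a \<in> Poly_Mapping.keys p" "b \<in> Poly_Mapping.keys q"
        using keys_mult[of p q] by auto
      have "Poly_Mapping.keys a \<subseteq> {..<r}" "Poly_Mapping.keys b \<subseteq> {..<r}"
        using p q ab by (simp_all add: poly_ring_def)
      then show ?thesis
        unfolding m using keys_add[of a b] by blast
    qed
    then show ?thesis by (simp add: poly_ring_def)
  qed
  show "abelian_group (poly_ring r :: 'k mpolynomial ring)"
  proof (rule abelian_groupI)
    fix p q s :: "'k mpolynomial"
    assume p: "p \<in> carrier (poly_ring r)" and q: "q \<in> carrier (poly_ring r)"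
    show "p \<oplus>\<^bsub>poly_ring r\<^esub> q \<in> carrier (poly_ring r)"
      using closed_add[OF p q] by (simp add: poly_ring_def)
    show "p \<oplus>\<^bsub>poly_ring r\<^esub> q = q \<oplus>\<^bsub>poly_ring r\<^esub> p"
      by (simp add: poly_ring_def add.commute)
    show "(p \<oplus>\<^bsub>poly_ring r\<^esub> q) \<oplus>\<^bsub>poly_ring r\<^esub> s =
        p \<oplus>\<^bsub>poly_ring r\<^esub> (q \<oplus>\<^bsub>poly_ring r\<^esub> s)"
      by (simp add: poly_ring_def add.assoc)
    have "- p \<in> carrier (poly_ring r)" using p by (simp add: poly_ring_def)
    then show "\<exists>u\<in>carrier (poly_ring r). u \<oplus>\<^bsub>poly_ring r\<^esub> p = \<zero>\<^bsub>poly_ring r\<^esub>"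
      by (intro bexI[of _ "- p"]) (simp_all add: poly_ring_def)
  qed (simp_all add: poly_ring_def)
  show "comm_monoid (poly_ring r :: 'k mpolynomial ring)"
  proof (rule comm_monoidI)
    fix p q s :: "'k mpolynomial"
    assume p: "p \<in> carrier (poly_ring r)" and q: "q \<in> carrier (poly_ring r)"
    show "p \<otimes>\<^bsub>poly_ring r\<^esub> q \<in> carrier (poly_ring r)"
      using closed_mult[OF p q] by (simp add: poly_ring_def)
    show "p \<otimes>\<^bsub>poly_ring r\<^esub> q = q \<otimes>\<^bsub>poly_ring r\<^esub> p"
      by (simp add: poly_ring_def mult.commute)
    show "(p \<otimes>\<^bsub>poly_ring r\<^esub> q) \<otimes>\<^bsub>poly_ring r\<^esub> s =
        p \<otimes>\<^bsub>poly_ring r\<^esub> (q \<otimes>\<^bsub>poly_ring r\<^esub> s)"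
      by (simp add: poly_ring_def mult.assoc)
  qed (simp_all add: poly_ring_def)
qed (simp add: poly_ring_def distrib_right)

definition artinian_ring :: "'a ring \<Rightarrow> bool" where
  "artinian_ring A \<longleftrightarrow> ring A \<and>
    (\<forall>J :: nat \<Rightarrow> 'a set. (\<forall>n. ideal (J n) A) \<and> (\<forall>n. J (Suc n) \<subseteq> J n) \<longrightarrow>
      (\<exists>N. \<forall>n\<ge>N. J n = J N))"

text \<open>
  The algebra is \<open>A = poly_ring r Quot I\<close>, whose elements are the cosets of \<open>I\<close>. The condition
  \<open>0 < r\<close> amounts to \<open>e \<ge> 1\<close>, because \<open>I\<close> contains no linear forms.
\<close>

definition standard_graded_artinian :: "nat \<Rightarrow> 'k::field mpolynomial set \<Rightarrow> bool" where
  "standard_graded_artinian r I \<longleftrightarrow>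
    0 < r \<and> homogeneous_ideal r I \<and> I \<inter> forms r 1 \<subseteq> {0} \<and>
    artinian_ring (poly_ring r Quot I)"

definition residue_class ::
  "nat \<Rightarrow> 'k::field mpolynomial set \<Rightarrow> 'k mpolynomial \<Rightarrow> 'k mpolynomial set" where
  "residue_class r I p = I +>\<^bsub>poly_ring r\<^esub> p"

definition scalars :: "nat \<Rightarrow> 'k::field mpolynomial set \<Rightarrow> 'k mpolynomial set set" where
  "scalars r I = residue_class r I ` range const_poly"

definition graded_piece ::
  "nat \<Rightarrow> 'k::field mpolynomial set \<Rightarrow> nat \<Rightarrow> 'k mpolynomial set set" where
  "graded_piece r I i = residue_class r I ` forms r i"

definition maximal_graded_ideal :: "nat \<Rightarrow> 'k::field mpolynomial set \<Rightarrow> 'k mpolynomial set set" where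
  "maximal_graded_ideal r I =
    genideal (poly_ring r Quot I) ((\<lambda>j. residue_class r I (var_poly j)) ` {..<r})"

definition socle :: "nat \<Rightarrow> 'k::field mpolynomial set \<Rightarrow> 'k mpolynomial set set" where
  "socle r I = {a \<in> carrier (poly_ring r Quot I).
    \<forall>b\<in>maximal_graded_ideal r I. a \<otimes>\<^bsub>poly_ring r Quot I\<^esub> b = \<zero>\<^bsub>poly_ring r Quot I\<^esub>}"

text \<open>
  Vectors \<open>(h\<^sub>0, \<dots>, h\<^sub>e)\<close> are encoded as functions on all of \<open>nat\<close>, extended by zero beyond \<open>e\<close>.
\<close>

definition h_vector :: "nat \<Rightarrow> 'k::field mpolynomial set \<Rightarrow> nat \<Rightarrow> nat" where
  "h_vector r I i = ring.dim (poly_ring r Quot I) (scalars r I) (graded_piece r I i)"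

definition socle_vector :: "nat \<Rightarrow> 'k::field mpolynomial set \<Rightarrow> nat \<Rightarrow> nat" where
  "socle_vector r I i =
    ring.dim (poly_ring r Quot I) (scalars r I) (socle r I \<inter> graded_piece r I i)"

definition is_h_vector :: "'k::field itself \<Rightarrow> (nat \<Rightarrow> nat) \<Rightarrow> bool" where
  "is_h_vector K h \<longleftrightarrow>
    (\<exists>r. \<exists>I :: 'k mpolynomial set. standard_graded_artinian r I \<and> h_vector r I = h)"

text \<open>
  The tops of the binomials in \<open>n = (a\<^sub>i choose i) + \<dots> + (a\<^sub>j choose j)\<close> are the values of \<open>a\<close> on
  \<open>{j..i}\<close>; the other values of \<open>a\<close> are irrelevant.
\<close>

definition binomial_expansion :: "nat \<Rightarrow> nat \<Rightarrow> nat \<Rightarrow> (nat \<Rightarrow> nat) \<Rightarrow> bool" where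
  "binomial_expansion n i j a \<longleftrightarrow>
    1 \<le> j \<and> j \<le> i \<and> j \<le> a j \<and> strict_mono_on {j..i} a \<and> n = (\<Sum>l=j..i. a l choose l)"

text \<open>
  \<open>lower_shift n i\<close> is \<open>((n\<^sub>(\<^sub>i\<^sub>))\<^sup>-\<^sup>1\<^sub>-\<^sub>1)\<close>: the expansion of
  \<open>n\<close> with both the tops and the bottoms of the binomials lowered by one. It is meaningful
  for \<open>n > 0\<close> and \<open>i > 0\<close>, where the expansion exists and is unique; then
  \<open>a l \<ge> l \<ge> 1\<close>, so the subtractions do not truncate.
\<close>

definition lower_shift :: "nat \<Rightarrow> nat \<Rightarrow> nat" where
  "lower_shift n i =
    (THE v. \<exists>j a. binomial_expansion n i j a \<and> v = (\<Sum>l=j..i. (a l - 1) choose (l - 1)))"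

end

theory Submission
  imports Defs "HOL-Library.Multiset_Order"
begin

text \<open>
  Both algebras are quotients by monomial ideals, where the two vectors are counts. Let \<open>M d\<close> be the
  set of monomials of degree \<open>d\<close> outside the ideal, and let the \<^emph>\<open>shadow\<close> of a set of monomials consist
  of the quotients of its members by single variables. Ideals correspond to sequences with
  \<open>shadow (M (d + 1)) \<subseteq> M d\<close>; then \<open>h\<^sub>d = card (M d)\<close>, and the socle in degree \<open>d\<close> is spanned by the
  monomials of \<open>M d\<close> outside \<open>shadow (M (d + 1))\<close>, so that
  \<open>s\<^sub>d = card (M d) - card (shadow (M (d + 1)))\<close>. It suffices to find two such sequences with
  \<open>card (M d) = h\<^sub>d\<close> for all \<open>d\<close> whose shadows have different sizes in some degree.

  The first sequence takes for \<open>L d\<close> the \<open>h\<^sub>d\<close> smallest monomials of degree \<open>d\<close> (so the ideal is a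
  lexsegment ideal). The monomials that are not leading monomials in the defining ideal of a
  given algebra with \<open>h\<close>-vector \<open>h\<close> have the same counts and are closed under division
  (\<open>h_vector_order_sequence\<close>), and by Macaulay's theorem an initial segment has the smallest shadow
  among all sets of its size (\<open>macaulay_finite\<close>), hence \<open>shadow (L (d + 1)) \<subseteq> L d\<close>. The
  shadow of the initial segment of size \<open>n\<close> in degree \<open>d\<close> has \<open>lower_shift n d\<close> elements
  (\<open>lower_shift_initial_segment\<close>). So \<open>s\<close> is the socle-vector of this first algebra, and \<open>s\<^sub>d \<noteq> 0\<close>
  says that \<open>shadow (L (d + 1))\<close> is a proper subset of \<open>L d\<close>.

  The second sequence arises from the first by exchanging one monomial of \<open>L (d + 1)\<close> so that its
  shadow grows by at least one element, which \<open>s\<^sub>d \<noteq> 0\<close> leaves room for. If \<open>s\<^sub>d\<^sub>+\<^sub>1 \<noteq> 0\<close>,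
  the largest monomial of \<open>L (d + 1)\<close> is not needed to support degree \<open>d + 2\<close> and can be given up.
  Under condition (ii) it is replaced by the monomial that follows \<open>L (d + 1)\<close>
  (\<open>exchange_Max_next\<close>). Under condition (iii), \<open>d + 1 = e\<close>, nothing has to be supported
  in the next degree, and the smallest monomial is given up instead (\<open>exchange_Min_top\<close>). Under condition (i),
  with \<open>d = t + 1\<close>, the set \<open>L t\<close> contains all monomials of its degree, so the set in degree \<open>t + 1\<close>
  may be chosen freely around the shadow, and a (nearly) pure power of the largest
  variable can be added in degree \<open>t + 2\<close> (\<open>exchange_Max_pure_power\<close>).

  Monomials are multisets of variable indices, compared by the multiset order: the largest index with
  different multiplicities decides. Thus the variable \<open>0\<close> is the smallest one, and initial
  segments do not change when larger variables are added. The monomials of degree \<open>d\<close> in the variables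
  below \<open>r\<close> form the set \<open>multisets_of_size {..<r} d\<close>.
\<close>

section \<open>Initial segments and shadows\<close>

definition shadow :: "'a multiset set \<Rightarrow> 'a multiset set" where
  "shadow X = {M. \<exists>x. add_mset x M \<in> X}"

definition initial_segment :: "nat set \<Rightarrow> nat \<Rightarrow> nat multiset set \<Rightarrow> bool" where
  "initial_segment W d S \<longleftrightarrow> S \<subseteq> multisets_of_size W d \<and>
     (\<forall>A\<in>S. \<forall>B\<in>multisets_of_size W d. B < A \<longrightarrow> B \<in> S)"

lemma shadow_subset:
  assumes "X \<subseteq> multisets_of_size W (Suc d)"
  shows "shadow X \<subseteq> multisets_of_size W d"
  using assms by (fastforce simp: shadow_def multisets_of_size_def)

lemma shadow_mono: "X \<subseteq> Y \<Longrightarrow> shadow X \<subseteq> shadow Y"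
  by (auto simp: shadow_def)

lemma finite_subset_multisets_of_size:
  assumes "finite W" "X \<subseteq> multisets_of_size W d"
  shows "finite X"
  using assms finite_multisets_of_size finite_subset by blast

lemma finite_shadow:
  assumes "finite X"
  shows "finite (shadow X)"
proof -
  have "shadow X \<subseteq> (\<Union>M\<in>X. (\<lambda>x. M - {#x#}) ` set_mset M)"
  proof
    fix M assume "M \<in> shadow X"
    then obtain x where "add_mset x M \<in> X" by (auto simp: shadow_def)
    then show "M \<in> (\<Union>M\<in>X. (\<lambda>x. M - {#x#}) ` set_mset M)"
      by (intro UN_I[of "add_mset x M"] image_eqI[of _ _ x]) auto
  qed
  then show ?thesis using assms by (meson finite_UN finite_imageI finite_set_mset finite_subset)
qed

text \<open>
  Segments of one degree form a chain, so one segment contains another as soon as it is at least as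
  large. Most inclusions below are obtained from a comparison of cardinalities in this way.
\<close>

lemma initial_segment_nested:
  assumes "initial_segment W d S" "initial_segment W d T"
  shows "S \<subseteq> T \<or> T \<subseteq> S"
proof (rule ccontr)
  assume "\<not> ?thesis"
  then obtain A B where "A \<in> S" "A \<notin> T" "B \<in> T" "B \<notin> S" by blast
  moreover have "A < B \<or> B < A" using calculation by (metis linorder_less_linear)
  ultimately show False using assms unfolding initial_segment_def by blast
qed

lemma initial_segment_subset_card:
  assumes "finite W" "initial_segment W d S" "initial_segment W d T" "card S \<le> card T"
  shows "S \<subseteq> T"
proof -
  have "finite S" "finite T"
    using assms finite_subset_multisets_of_size unfolding initial_segment_def by blast+
  then show ?thesis
    using initial_segment_nested[OF assms(2,3)] assms(4) by (metis card_seteq order_refl)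
qed

lemma initial_segment_insert_Min:
  assumes "finite W" "initial_segment W d S" "S \<noteq> multisets_of_size W d"
  defines "b \<equiv> Min (multisets_of_size W d - S)"
  shows "initial_segment W d (insert b S)" "b \<in> multisets_of_size W d" "b \<notin> S"
proof -
  have S: "S \<subseteq> multisets_of_size W d" using assms by (auto simp: initial_segment_def)
  have fin: "finite (multisets_of_size W d - S)" using assms(1) by auto
  have ne: "multisets_of_size W d - S \<noteq> {}" using S assms(3) by blast
  have b: "b \<in> multisets_of_size W d - S" unfolding b_def using Min_in[OF fin ne] .
  then show "b \<in> multisets_of_size W d" "b \<notin> S" by auto
  have "B \<in> S" if "B \<in> multisets_of_size W d" "B < b" for B
    using Min_le[OF fin, of B] that unfolding b_def by force
  then show "initial_segment W d (insert b S)"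
    using assms(2) b unfolding initial_segment_def by blast
qed

lemma initial_segment_exists:
  assumes "finite W" "n \<le> card (multisets_of_size W d)"
  shows "\<exists>S. initial_segment W d S \<and> card S = n"
  using assms(2)
proof (induction n)
  case 0
  then show ?case by (intro exI[of _ "{}"]) (auto simp: initial_segment_def)
next
  case (Suc n)
  then obtain S where S: "initial_segment W d S" "card S = n" by auto
  have "S \<noteq> multisets_of_size W d" using S Suc by auto
  note ins = initial_segment_insert_Min[OF assms(1) S(1) this]
  have "finite S" using S assms(1) finite_subset_multisets_of_size unfolding initial_segment_def by blast
  then have "card (insert (Min (multisets_of_size W d - S)) S) = Suc n"
    using ins S by simp
  then show ?case using ins by blast
qed

lemma stable_shadow:
  assumes "\<And>x M. add_mset x M \<in> X \<Longrightarrow> add_mset z M \<in> X"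
  shows "shadow X = {M. add_mset z M \<in> X}"
  using assms by (auto simp: shadow_def)

text \<open>
  If any variable of a member may be replaced by \<open>z\<close>, the shadow is already obtained by dividing by \<open>z\<close>
  alone, and this division is injective. In particular this applies to initial segments, with \<open>z\<close> the
  smallest variable.
\<close>

lemma card_stable_shadow:
  assumes "\<And>x M. add_mset x M \<in> X \<Longrightarrow> add_mset z M \<in> X"
  shows "card (shadow X) = card {M \<in> X. z \<in># M}"
proof -
  have "add_mset z ` {M. add_mset z M \<in> X} = {M \<in> X. z \<in># M}"
    by (auto simp: image_iff dest: multi_member_split)
  moreover have "shadow X = {M. add_mset z M \<in> X}"
    by (rule stable_shadow) (rule assms)
  ultimately show ?thesis
    using card_image[of "add_mset z" "{M. add_mset z M \<in> X}"] by (simp add: inj_on_def)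
qed

lemma initial_segment_stable:
  assumes "initial_segment W (Suc d) S" "z \<in> W" "\<And>x. x \<in> W \<Longrightarrow> z \<le> x" "add_mset x M \<in> S"
  shows "add_mset z M \<in> S"
proof -
  have "add_mset x M \<in> multisets_of_size W (Suc d)"
    using assms(1,4) unfolding initial_segment_def by blast
  then have M: "set_mset M \<subseteq> W" "size M = d" "x \<in> W"
    by (auto simp: multisets_of_size_def)
  then have in_W: "add_mset z M \<in> multisets_of_size W (Suc d)"
    using assms by (auto simp: multisets_of_size_def)
  have "add_mset z M \<le> add_mset x M"
    using add_mset_le_left_le[OF assms(3)[OF M(3)]] .
  then show ?thesis
    using assms(1,4) in_W unfolding initial_segment_def by (metis order_le_less)
qed

lemma initial_segment_shadow:
  assumes "initial_segment W (Suc d) S" "z \<in> W" "\<And>x. x \<in> W \<Longrightarrow> z \<le> x"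
  shows "initial_segment W d (shadow S)"
  unfolding initial_segment_def
proof (intro conjI ballI impI)
  show "shadow S \<subseteq> multisets_of_size W d"
    using assms(1) shadow_subset by (auto simp: initial_segment_def)
  note eq = stable_shadow[OF initial_segment_stable[OF assms]]
  fix A B assume AB: "A \<in> shadow S" "B \<in> multisets_of_size W d" "B < A"
  then have "add_mset z A \<in> S" using eq by auto
  moreover have "add_mset z B < add_mset z A" using AB by simp
  moreover have "add_mset z B \<in> multisets_of_size W (Suc d)"
    using AB assms(2) by (auto simp: multisets_of_size_def)
  ultimately have "add_mset z B \<in> S"
    using assms(1) by (auto simp: initial_segment_def)
  then show "B \<in> shadow S" by (auto simp: shadow_def)
qed

text \<open>
  Macaulay's theorem for the variables \<open>W\<close>. It is a predicate of \<open>W\<close> because compression uses it for subsets of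
  the variables.
\<close>

definition macaulay :: "nat set \<Rightarrow> bool" where
  "macaulay W \<longleftrightarrow> (\<forall>d X S. X \<subseteq> multisets_of_size W (Suc d) \<longrightarrow> initial_segment W (Suc d) S \<longrightarrow>
     card X = card S \<longrightarrow> card (shadow S) \<le> card (shadow X))"

section \<open>Compression\<close>

text \<open>
  Compression with respect to a set \<open>V\<close> of variables works on the fibres over the monomials \<open>u\<close> in the
  variables outside \<open>V\<close>.
\<close>

definition fibre :: "nat set \<Rightarrow> nat multiset set \<Rightarrow> nat multiset \<Rightarrow> nat multiset set" where
  "fibre V X u = {w. set_mset w \<subseteq> V \<and> u + w \<in> X}"

definition outer :: "nat set \<Rightarrow> nat \<Rightarrow> nat multiset set" where
  "outer V d = (\<Union>k\<le>d. multisets_of_size V k)"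

lemma outer_iff: "u \<in> outer V d \<longleftrightarrow> set_mset u \<subseteq> V \<and> size u \<le> d"
  by (auto simp: outer_def multisets_of_size_def)

lemma finite_outer: "finite V \<Longrightarrow> finite (outer V d)"
  by (auto simp: outer_def)

lemma fibre_subset:
  assumes "X \<subseteq> multisets_of_size W d"
  shows "fibre V X u \<subseteq> multisets_of_size V (d - size u)"
  using assms by (auto simp: fibre_def multisets_of_size_def)

lemma outer_inner_unique:
  fixes u w :: "nat multiset"
  assumes "set_mset u \<subseteq> W - V" "set_mset w \<subseteq> V"
  shows "filter_mset (\<lambda>x. x \<notin> V) (u + w) = u" "filter_mset (\<lambda>x. x \<in> V) (u + w) = w"
proof -
  have all: "filter_mset P M = M" if "\<forall>x\<in>#M. P x" for P and M :: "nat multiset"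
    using that by (induction M) auto
  have none: "filter_mset P M = {#}" if "\<forall>x\<in>#M. \<not> P x" for P and M :: "nat multiset"
    using that by (induction M) auto
  show "filter_mset (\<lambda>x. x \<notin> V) (u + w) = u" "filter_mset (\<lambda>x. x \<in> V) (u + w) = w"
    using assms all[of w "\<lambda>x. x \<in> V"] all[of u "\<lambda>x. x \<notin> V"]
      none[of u "\<lambda>x. x \<in> V"] none[of w "\<lambda>x. x \<notin> V"] by (simp_all add: subset_iff)
qed

lemma sum_fibres:
  assumes "finite W" "X \<subseteq> multisets_of_size W d"
  shows "sum f X = (\<Sum>u\<in>outer (W - V) d. \<Sum>w\<in>fibre V X u. f (u + w))"
proof -
  have fin: "finite (fibre V X u)" for u
    unfolding fibre_def
    by (rule finite_subset[OF _ finite_vimageI[OF finite_subset_multisets_of_size[OF assms], of "(+) u"]])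
       auto
  have bij: "bij_betw (\<lambda>(u, w). u + w) (SIGMA u:outer (W - V) d. fibre V X u) X"
  proof (rule bij_betwI[of _ _ _ "\<lambda>M. (filter_mset (\<lambda>x. x \<notin> V) M, filter_mset (\<lambda>x. x \<in> V) M)"])
    show "(\<lambda>M. (filter_mset (\<lambda>x. x \<notin> V) M, filter_mset (\<lambda>x. x \<in> V) M))
      \<in> X \<rightarrow> (SIGMA u:outer (W - V) d. fibre V X u)"
    proof
      fix M assume M: "M \<in> X"
      have "filter_mset (\<lambda>x. x \<notin> V) M + filter_mset (\<lambda>x. x \<in> V) M = M"
        using multiset_partition[of M "\<lambda>x. x \<in> V"] by (simp add: add.commute)
      moreover have "size (filter_mset (\<lambda>x. x \<notin> V) M) \<le> d"
        using M assms(2) size_filter_mset_lesseq by (force simp: multisets_of_size_def)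
      ultimately show "(filter_mset (\<lambda>x. x \<notin> V) M, filter_mset (\<lambda>x. x \<in> V) M)
        \<in> (SIGMA u:outer (W - V) d. fibre V X u)"
        using M assms(2) by (auto simp: outer_iff fibre_def multisets_of_size_def)
    qed
  next
    fix M assume M: "M \<in> X"
    show "(case (filter_mset (\<lambda>x. x \<notin> V) M, filter_mset (\<lambda>x. x \<in> V) M) of (u, w) \<Rightarrow> u + w) = M"
      using multiset_partition[of M "\<lambda>x. x \<in> V"] by (simp add: add.commute)
  next
    fix p assume "p \<in> (SIGMA u:outer (W - V) d. fibre V X u)"
    then obtain u w where "p = (u, w)" "set_mset u \<subseteq> W - V" "set_mset w \<subseteq> V"
      by (auto simp: outer_iff fibre_def)
    then show "(\<lambda>M. (filter_mset (\<lambda>x. x \<notin> V) M, filter_mset (\<lambda>x. x \<in> V) M))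
        (case p of (u, w) \<Rightarrow> u + w) = p"
      using outer_inner_unique[of u W V w] by simp
  qed (auto simp: fibre_def)
  have "sum f X = (\<Sum>p\<in>(SIGMA u:outer (W - V) d. fibre V X u). f (case p of (u, w) \<Rightarrow> u + w))"
    using sum.reindex_bij_betw[OF bij, of f] by simp
  also have "\<dots> = (\<Sum>u\<in>outer (W - V) d. \<Sum>w\<in>fibre V X u. f (u + w))"
    using fin finite_outer[of "W - V" d] assms(1)
    by (subst sum.Sigma) (auto simp: case_prod_unfold)
  finally show ?thesis .
qed

lemma card_fibres:
  assumes "finite W" "X \<subseteq> multisets_of_size W d"
  shows "card X = (\<Sum>u\<in>outer (W - V) d. card (fibre V X u))"
  using sum_fibres[OF assms, of "\<lambda>_. 1::nat" V] by simp

text \<open>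
  A variable that is cancelled from \<open>u + w\<close> lies either in \<open>V\<close> or outside \<open>V\<close>. This description turns
  the minimality of shadows in the variables \<open>V\<close> into a statement about shadows in all variables.
\<close>

lemma fibre_shadow:
  assumes "X \<subseteq> multisets_of_size W d" "V \<subseteq> W" "set_mset u \<subseteq> W - V"
  shows "fibre V (shadow X) u = shadow (fibre V X u) \<union> (\<Union>x\<in>W - V. fibre V X (add_mset x u))"
proof (intro equalityI subsetI)
  fix w assume "w \<in> fibre V (shadow X) u"
  then obtain x where w: "set_mset w \<subseteq> V" and x: "add_mset x (u + w) \<in> X"
    by (auto simp: fibre_def shadow_def)
  have "x \<in> W" using x assms(1) by (auto simp: multisets_of_size_def)
  show "w \<in> shadow (fibre V X u) \<union> (\<Union>x\<in>W - V. fibre V X (add_mset x u))"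
  proof (cases "x \<in> V")
    case True
    then show ?thesis using w x by (auto simp: shadow_def fibre_def intro!: exI[of _ x])
  next
    case False
    then show ?thesis using w x \<open>x \<in> W\<close> by (auto simp: fibre_def)
  qed
qed (auto simp: shadow_def fibre_def)

lemma card_Union_initial_segments:
  assumes "finite W" "F \<noteq> {}" "\<And>S. S \<in> F \<Longrightarrow> initial_segment W d S" "\<And>S. S \<in> F \<Longrightarrow> card S \<le> c"
  shows "card (\<Union>F) \<le> c"
proof -
  have "F \<subseteq> Pow (multisets_of_size W d)" using assms(3) by (auto simp: initial_segment_def)
  then have "finite F" using assms(1) by (meson finite_Pow_iff finite_multisets_of_size finite_subset)
  have "Max (card ` F) \<in> card ` F" using \<open>finite F\<close> assms(2) by auto
  then obtain S where S: "S \<in> F" "card S = Max (card ` F)" by force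
  have "T \<subseteq> S" if "T \<in> F" for T
    using initial_segment_subset_card[OF assms(1) assms(3)[OF that] assms(3)[OF S(1)]] S that \<open>finite F\<close>
    by simp
  then have "\<Union>F = S" using S by blast
  then show ?thesis using assms(4)[OF S(1)] by simp
qed

text \<open>
  The weight \<open>f\<close> is a termination measure: replacing a set by a segment of the same size lowers
  its total weight.
\<close>

lemma sum_initial_segment:
  assumes "finite W" "initial_segment W d S" "X \<subseteq> multisets_of_size W d" "card S = card X"
    and mono: "\<And>A B. A \<in> multisets_of_size W d \<Longrightarrow> B \<in> multisets_of_size W d \<Longrightarrow> A < B \<Longrightarrow> f A < (f B :: nat)"
  shows "sum f S \<le> sum f X" "S \<noteq> X \<Longrightarrow> sum f S < sum f X"
proof -
  have S: "S \<subseteq> multisets_of_size W d" using assms(2) by (auto simp: initial_segment_def)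
  have fin: "finite S" "finite X" using assms(1,3) S finite_subset_multisets_of_size by blast+
  have "sum f S < sum f X" if "S \<noteq> X"
  proof -
    have card: "card (S - X) = card (X - S)"
      using assms(4) fin by (metis card_Diff_subset_Int finite_Int inf_commute)
    have ne: "S - X \<noteq> {}"
      using that card_subset_eq[OF fin(2) _ assms(4)] by blast
    define a where "a = Max (f ` (S - X))"
    have "a \<in> f ` (S - X)" unfolding a_def using fin ne by simp
    then obtain A where A: "A \<in> S" "A \<notin> X" "f A = a" by auto
    have le: "f C \<le> a" if "C \<in> S - X" for C unfolding a_def using that fin by simp
    have gt: "a < f B" if "B \<in> X - S" for B
    proof -
      have "A < B" using A that assms(2,3) unfolding initial_segment_def
        by (metis DiffD1 DiffD2 linorder_less_linear subsetD)
      then show ?thesis using A S assms(3) that mono by auto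
    qed
    have "sum f (S - X) \<le> card (S - X) * a"
      using sum_bounded_above[of "S - X" f a] le by simp
    also have "\<dots> < card (X - S) * Suc a"
    proof -
      have "0 < card (X - S)" using card ne fin by (metis card_gt_0_iff finite_Diff)
      then show ?thesis using card by simp
    qed
    also have "\<dots> \<le> sum f (X - S)"
      using sum_bounded_below[of "X - S" "Suc a" f] gt by (simp add: Suc_leI)
    finally have "sum f (S - X) < sum f (X - S)" .
    moreover have "sum f S = sum f (S \<inter> X) + sum f (S - X)"
      using fin by (metis sum.Int_Diff)
    moreover have "sum f X = sum f (S \<inter> X) + sum f (X - S)"
      using fin by (metis sum.Int_Diff Int_commute)
    ultimately show ?thesis by simp
  qed
  then show "sum f S \<le> sum f X" "S \<noteq> X \<Longrightarrow> sum f S < sum f X" by (cases "S = X"; simp)+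
qed

text \<open>
  Replacing each fibre by the segment of the same size does not enlarge the shadow. In the fibre of
  the shadow over \<open>u\<close>, the new pieces are segments, hence nested, and their union is just the largest of
  them; before the replacement the union contained pieces that were at least as large.
\<close>

lemma compression_step:
  assumes W: "finite W" "V \<subseteq> W" "V \<noteq> {}" "macaulay V"
    and X: "X \<subseteq> multisets_of_size W (Suc d)"
    and u0: "u0 \<in> outer (W - V) (Suc d)" "\<not> initial_segment V (Suc d - size u0) (fibre V X u0)"
    and mono: "\<And>A B. A \<in> multisets_of_size W (Suc d) \<Longrightarrow> B \<in> multisets_of_size W (Suc d) \<Longrightarrow>
                 A < B \<Longrightarrow> f A < (f B :: nat)"
  shows "\<exists>Y. Y \<subseteq> multisets_of_size W (Suc d) \<and> card Y = card X \<and> card (shadow Y) \<le> card (shadow X)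
           \<and> sum f Y < sum f X"
proof -
  have finV: "finite V" using W finite_subset by blast
  define S where "S u = (SOME S. initial_segment V (Suc d - size u) S \<and> card S = card (fibre V X u))" for u
  have S: "initial_segment V (Suc d - size u) (S u)" "card (S u) = card (fibre V X u)" for u
  proof -
    have "card (fibre V X u) \<le> card (multisets_of_size V (Suc d - size u))"
      using fibre_subset[OF X, of V u] finV by (simp add: card_mono finite_multisets_of_size)
    then have "\<exists>S. initial_segment V (Suc d - size u) S \<and> card S = card (fibre V X u)"
      using initial_segment_exists[OF finV] by blast
    from someI_ex[OF this]
    show "initial_segment V (Suc d - size u) (S u)" "card (S u) = card (fibre V X u)"
      unfolding S_def by auto
  qed
  define Y where "Y = {u + w | u w. u \<in> outer (W - V) (Suc d) \<and> w \<in> S u}"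
  have S_sub: "S u \<subseteq> multisets_of_size V (Suc d - size u)" for u
    using S(1) by (auto simp: initial_segment_def)
  have Y: "Y \<subseteq> multisets_of_size W (Suc d)"
    using S_sub W(2) by (fastforce simp: Y_def outer_iff multisets_of_size_def)
  have fib_Y: "fibre V Y u = S u" if "u \<in> outer (W - V) (Suc d)" for u
  proof
    show "S u \<subseteq> fibre V Y u"
      using S_sub[of u] that by (auto simp: fibre_def Y_def multisets_of_size_def)
    show "fibre V Y u \<subseteq> S u"
    proof
      fix w assume "w \<in> fibre V Y u"
      then obtain u' w' where *: "set_mset w \<subseteq> V" "u + w = u' + w'" "u' \<in> outer (W - V) (Suc d)"
          "w' \<in> S u'" by (auto simp: fibre_def Y_def)
      have "set_mset w' \<subseteq> V" using * S_sub[of u'] by (auto simp: multisets_of_size_def)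
      then have "u = u'" "w = w'"
        using outer_inner_unique[of u W V w] outer_inner_unique[of u' W V w'] * that
        by (auto simp: outer_iff)
      then show "w \<in> S u" using * by simp
    qed
  qed
  have "card Y = card X"
    unfolding card_fibres[OF W(1) Y, of V] card_fibres[OF W(1) X, of V]
    by (intro sum.cong) (simp_all add: fib_Y S)
  moreover have "card (shadow Y) \<le> card (shadow X)"
    unfolding card_fibres[OF W(1) shadow_subset[OF Y], of V] card_fibres[OF W(1) shadow_subset[OF X], of V]
  proof (rule sum_mono)
    fix u assume u: "u \<in> outer (W - V) d"
    then have u': "u \<in> outer (W - V) (Suc d)" and u'': "set_mset u \<subseteq> W - V" by (auto simp: outer_iff)
    have ux: "add_mset x u \<in> outer (W - V) (Suc d)" if "x \<in> W - V" for x
      using u that by (auto simp: outer_iff)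
    have Suc_d: "Suc d - size u = Suc (d - size u)" using u by (auto simp: outer_iff)
    define F where "F = insert (shadow (S u)) ((\<lambda>x. S (add_mset x u)) ` (W - V))"
    have "fibre V (shadow Y) u = \<Union>F"
      unfolding F_def fibre_shadow[OF Y W(2) u''] using fib_Y u' ux by auto
    moreover have "card (\<Union>F) \<le> card (fibre V (shadow X) u)"
    proof (rule card_Union_initial_segments[OF finV, where d = "d - size u"])
      have fin_fib: "finite (fibre V (shadow X) u)"
        using fibre_subset[OF shadow_subset[OF X], of V u] finV finite_subset_multisets_of_size by blast
      fix T assume "T \<in> F"
      then consider "T = shadow (S u)" | x where "x \<in> W - V" "T = S (add_mset x u)"
        by (auto simp: F_def)
      then have "initial_segment V (d - size u) T \<and> card T \<le> card (fibre V (shadow X) u)"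
      proof cases
        case 1
        have seg: "initial_segment V (Suc (d - size u)) (S u)" using S(1)[of u] Suc_d by simp
        have "card (shadow (S u)) \<le> card (shadow (fibre V X u))"
          using W(4) seg fibre_subset[OF X, of V u] S(2)[of u] unfolding macaulay_def Suc_d by auto
        also have "\<dots> \<le> card (fibre V (shadow X) u)"
          using fibre_shadow[OF X W(2) u''] fin_fib by (intro card_mono) auto
        finally show ?thesis
          using 1 initial_segment_shadow[OF seg Min_in[OF finV W(3)]] finV by simp
      next
        case 2
        have "card (fibre V X (add_mset x u)) \<le> card (fibre V (shadow X) u)"
          using fibre_shadow[OF X W(2) u''] fin_fib 2 by (intro card_mono) auto
        then show ?thesis using 2 S[of "add_mset x u"] by simp
      qed
      then show "initial_segment V (d - size u) T" "card T \<le> card (fibre V (shadow X) u)" by auto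
    qed (simp add: F_def)
    ultimately show "card (fibre V (shadow Y) u) \<le> card (fibre V (shadow X) u)" by simp
  qed
  moreover have "sum f Y < sum f X"
    unfolding sum_fibres[OF W(1) Y, of f V] sum_fibres[OF W(1) X, of f V]
  proof (rule sum_strict_mono_ex1)
    have fmono: "f (u + A) < f (u + B)"
      if "u \<in> outer (W - V) (Suc d)" "A \<in> multisets_of_size V (Suc d - size u)"
         "B \<in> multisets_of_size V (Suc d - size u)" "A < B" for u A B
      using that W(2) by (intro mono) (auto simp: multisets_of_size_def outer_iff)
    show "\<forall>u\<in>outer (W - V) (Suc d). (\<Sum>w\<in>fibre V Y u. f (u + w)) \<le> (\<Sum>w\<in>fibre V X u. f (u + w))"
      using sum_initial_segment(1)[OF finV S(1) fibre_subset[OF X] S(2) fmono] fib_Y by simp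
    have "S u0 \<noteq> fibre V X u0" using u0(2) S(1)[of u0] by metis
    then show "\<exists>u\<in>outer (W - V) (Suc d). (\<Sum>w\<in>fibre V Y u. f (u + w)) < (\<Sum>w\<in>fibre V X u. f (u + w))"
      using sum_initial_segment(2)[OF finV S(1) fibre_subset[OF X] S(2) fmono, OF u0(1)] fib_Y[OF u0(1)] u0(1)
      by (intro bexI[of _ u0]) simp_all
  qed (use W finite_outer in auto)
  ultimately show ?thesis using Y by blast
qed

section \<open>Macaulay's theorem on shadows\<close>

text \<open>
  In two variables the monomials of degree \<open>d + 1\<close> form a chain. If a set misses some monomial \<open>N\<close> of
  this chain, dividing the members with more \<open>z\<close> than \<open>N\<close> by \<open>z\<close> and the others by \<open>j\<close> embeds the set
  into its shadow, whereas the shadow of a segment is never larger than the segment.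
\<close>

lemma macaulay_pair:
  assumes "z < j"
  shows "macaulay {z, j}"
  unfolding macaulay_def
proof (intro allI impI)
  fix d X S
  assume X: "X \<subseteq> multisets_of_size {z, j} (Suc d)" and S: "initial_segment {z, j} (Suc d) S"
    and card: "card X = card S"
  have fin: "finite X" "finite S"
    using X S finite_subset_multisets_of_size[of "{z, j}"] by (auto simp: initial_segment_def)
  show "card (shadow S) \<le> card (shadow X)"
  proof (cases "X = multisets_of_size {z, j} (Suc d)")
    case True
    then have "S = X"
      using S card fin card_subset_eq[of X S] by (auto simp: initial_segment_def)
    then show ?thesis by simp
  next
    case False
    then obtain N where N: "N \<in> multisets_of_size {z, j} (Suc d)" "N \<notin> X" using X by blast
    have size: "count M z + count M j = Suc d" if "M \<in> multisets_of_size {z, j} (Suc d)" for M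
      using that assms by (auto simp: multisets_of_size_def size_multiset_overloaded_eq
          sum.mono_neutral_left[of "{z, j}" "set_mset M" "count M"] count_eq_zero_iff)
    have eqI: "M = M'" if "M \<in> multisets_of_size {z, j} (Suc d)" "M' \<in> multisets_of_size {z, j} (Suc d)"
      "count M z = count M' z" for M M'
    proof (rule multiset_eqI)
      fix x
      show "count M x = count M' x"
        using that size[OF that(1)] size[OF that(2)]
        by (cases "x = z \<or> x = j") (auto simp: multisets_of_size_def count_eq_zero_iff subset_iff, metis count_eq_zero_iff)
    qed
    have jM: "j \<in># M" if "M \<in> X" "count M z \<le> count N z" for M
    proof -
      have M: "M \<in> multisets_of_size {z, j} (Suc d)" using X that by blast
      have "count M z \<noteq> count N z" using eqI[OF M N(1)] that N(2) by blast
      then show ?thesis using size[OF M] size[OF N(1)] that(2)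
        by (metis add.right_neutral count_greater_zero_iff le_add1 le_antisym not_gr_zero)
    qed
    have count_N: "count M z \<noteq> count N z" if "M \<in> X" for M
      using eqI[of M N] that N X by blast
    \<comment> \<open>The multiplicity of \<open>z\<close> stays at least that of \<open>N\<close> on the first branch and below it on the second.\<close>
    define g where "g M = (if count N z < count M z then M - {#z#} else M - {#j#})" for M
    have "inj_on g X"
    proof (rule inj_onI)
      fix M M' assume *: "M \<in> X" "M' \<in> X" "g M = g M'"
      have zz: "z \<in># M" if "count N z < count M z" for M :: "nat multiset"
        using that count_greater_zero_iff[of M z] by linarith
      have c1: "count N z \<le> count (g M) z" if "count N z < count M z" for M
        using that by (auto simp: g_def)
      have c2: "count (g M) z < count N z" if "\<not> count N z < count M z" "M \<in> X" for M
        using that count_N[of M] assms by (auto simp: g_def)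
      have iff: "count N z < count M z \<longleftrightarrow> count N z < count M' z"
        using c1[of M] c1[of M'] c2[of M] c2[of M'] * by fastforce
      show "M = M'"
        using * iff zz jM[of M] jM[of M'] unfolding g_def
        by (metis insert_DiffM linorder_not_less)
    qed
    moreover have "g ` X \<subseteq> shadow X"
    proof
      fix A assume "A \<in> g ` X"
      then obtain M where M: "M \<in> X" "A = g M" by auto
      show "A \<in> shadow X"
      proof (cases "count N z < count M z")
        case True
        then have "z \<in># M" using count_greater_zero_iff[of M z] by linarith
        then show ?thesis using M True by (auto simp: shadow_def g_def intro!: exI[of _ z])
      next
        case False
        then have "j \<in># M" using jM M by simp
        then show ?thesis using M False by (auto simp: shadow_def g_def intro!: exI[of _ j])
      qed
    qed
    ultimately have "card X \<le> card (shadow X)"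
      using card_inj_on_le finite_shadow[OF fin(1)] by blast
    moreover have "card (shadow S) \<le> card S"
    proof -
      have "card (shadow S) = card {M \<in> S. z \<in># M}"
        by (rule card_stable_shadow[OF initial_segment_stable[OF S]]) (use assms in auto)
      also have "\<dots> \<le> card S" using fin by (intro card_mono) auto
      finally show ?thesis .
    qed
    ultimately show ?thesis using card by simp
  qed
qed

text \<open>
  Unless they are equal and \<open>k = 0\<close>, the largest index \<open>p\<close> where \<open>replicate_mset k z + u\<close> and \<open>B\<close> differ cannot be \<open>z\<close>, because \<open>B\<close> has the
  larger multiplicity at \<open>p\<close> and does not contain \<open>z\<close>. If \<open>p > y\<close>, it still decides after \<open>z\<close> has been replaced by
  the second smallest variable \<open>y\<close>; if \<open>p = y\<close>, the two multisets agree beyond \<open>y\<close> and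
  have equal size, so they become equal.
\<close>

lemma replace_least_le:
  fixes u B :: "nat multiset"
  assumes "replicate_mset k z + u \<le> B" "size B = k + size u" "z < y"
    and y_least: "\<And>p. p \<in># u + B \<Longrightarrow> y \<le> p"
  shows "replicate_mset k y + u \<le> B"
proof (rule ccontr)
  let ?A = "replicate_mset k z + u" and ?A' = "replicate_mset k y + u"
  assume "\<not> ?A' \<le> B"
  then have neq: "?A' \<noteq> B" and nlt: "\<not> ?A' < B" by auto
  have zero: "count u p = 0" "count B p = 0" if "p < y" for p
    using y_least[of p] that by (auto simp flip: not_in_iff)
  have cA: "count ?A p = count u p" if "p \<noteq> z" for p using that by auto
  have cA': "count ?A' p = count u p" if "p \<noteq> y" for p using that by auto
  have lt: "?A < B \<or> k = 0"
  proof (rule ccontr)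
    assume "\<not> ?thesis"
    then have "?A = B" "k \<noteq> 0" using assms(1) by auto
    then have "z \<in># B" by (auto dest!: sym[of _ B])
    then show False using y_least[of z] assms(3) by simp
  qed
  have "\<exists>q>p. count ?A' q < count B q" if p: "count B p < count ?A' p" for p
  proof (cases "p = y")
    case True
    have "size ?A' = size B" using assms(2) by simp
    have "\<not> B \<subset># ?A'"
      using \<open>size ?A' = size B\<close> by (metis mset_subset_size less_irrefl)
    then obtain q where q: "count ?A' q < count B q"
      using neq unfolding subset_mset_def subseteq_mset_def by (metis linorder_not_le)
    have "q \<noteq> y" using q p True by auto
    moreover have "\<not> q < y" using zero[of q] q by auto
    ultimately show ?thesis using q True by (intro exI[of _ q]) auto
  next
    case False
    then have "y < p" using zero[of p] p cA'[of p] by (metis linorder_neqE_nat not_less_zero)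
    have "?A < B" using lt
    proof
      assume "k = 0"
      then show ?thesis using assms(1) neq by (simp add: order_le_less)
    qed
    moreover have "count B p < count ?A p" using p cA'[OF False] cA[of p] \<open>y < p\<close> assms(3) by simp
    ultimately obtain q where q: "q > p" "count ?A q < count B q"
      unfolding less_multiset\<^sub>H\<^sub>O by blast
    then show ?thesis using \<open>y < p\<close> assms(3) by (intro exI[of _ q]) auto
  qed
  then have "?A' < B" unfolding less_multiset\<^sub>H\<^sub>O using neq by blast
  then show False using nlt by simp
qed

text \<open>
  Induction on the number of variables. Among the sets of a given size with shadow at most that of \<open>X\<close>,
  let \<open>Y\<close> have the smallest total weight. Then \<open>Y\<close> is fixed by the compressions with respect to all pairs
  \<open>{z, x}\<close> and to \<open>W - {z}\<close>, where \<open>z\<close> is the smallest variable. The pairs make \<open>Y\<close> stable under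
  replacing a variable by \<open>z\<close>, so its shadow has as many elements as \<open>Y\<close> has
  multiples of \<open>z\<close>; the same holds for the segment \<open>S\<close>. It remains to see that \<open>Y\<close> has at most as
  many members without \<open>z\<close> as \<open>S\<close>. Let \<open>B\<close> be the largest of these members. Replacing \<open>z\<close> by the second smallest
  variable \<open>y\<close> keeps a monomial below \<open>B\<close> and makes it a member by compression with respect to
  \<open>W - {z}\<close>; stability brings the original monomial back into \<open>Y\<close>. Hence \<open>Y\<close>
  contains everything up to \<open>B\<close>, and so does \<open>S\<close>, having the same size.
\<close>

lemma macaulay_finite:
  assumes "finite W"
  shows "macaulay W"
  using assms
proof (induction "card W" arbitrary: W rule: less_induct)
  case less
  show ?case
  proof (cases "card W \<le> 2")
    case True
    then consider "W = {}" | x where "W = {x}" | x y where "W = {x, y}" "x < y"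
      using less.prems
      by (metis One_nat_def Suc_1 card_0_eq card_1_singletonE card_2_iff doubleton_eq_iff le_SucE le_zero_eq linorder_neqE_nat)
    then show ?thesis
    proof cases
      case 1
      then show ?thesis by (auto simp: macaulay_def initial_segment_def)
    next
      case (2 x)
      have "multisets_of_size {x} d = {replicate_mset d x}" for d
        by (auto simp: multisets_of_size_def set_mset_subset_singletonD split: if_splits)
      then show ?thesis unfolding 2 macaulay_def initial_segment_def
        by (metis card.empty card_0_eq finite.emptyI finite_insert finite_subset order_refl subset_singletonD)
    next
      case 3
      then show ?thesis using macaulay_pair by simp
    qed
  next
    case False
    then have card_W: "3 \<le> card W" by simp
    define z where "z = Min W"
    define y where "y = Min (W - {z})"
    have "W \<noteq> {}" using card_W by auto
    then have z: "z \<in> W" "\<And>x. x \<in> W \<Longrightarrow> z \<le> x" using less.prems by (auto simp: z_def)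
    have card_V: "card (W - {z}) < card W" "W - {z} \<noteq> {}"
    proof -
      have "card (W - {z}) = card W - 1" using z(1) by (simp add: card_Diff_singleton)
      then show "card (W - {z}) < card W" "W - {z} \<noteq> {}"
        using card_W by (linarith, force)
    qed
    have y: "y \<in> W" "y \<noteq> z" "\<And>x. x \<in> W - {z} \<Longrightarrow> y \<le> x"
      using Min_in[of "W - {z}"] card_V(2) less.prems by (auto simp: y_def)
    then have "z < y" using z by (metis le_neq_implies_less)
    have mac_V: "macaulay (W - {z})" using less.hyps[OF card_V(1)] less.prems by simp
    show ?thesis
      unfolding macaulay_def
    proof (intro allI impI)
      fix d X S
      assume X: "X \<subseteq> multisets_of_size W (Suc d)" and S: "initial_segment W (Suc d) S"
        and card: "card X = card S"
      \<comment> \<open>The rank of a monomial is a strictly increasing weight.\<close>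
      define f where "f M = card {N \<in> multisets_of_size W (Suc d). N < M}" for M
      have f_mono: "f A < f B"
        if "A \<in> multisets_of_size W (Suc d)" "B \<in> multisets_of_size W (Suc d)" "A < B" for A B
        unfolding f_def using that less.prems
        by (intro psubset_card_mono) (auto simp: finite_multisets_of_size)
      define P where "P Y \<longleftrightarrow> Y \<subseteq> multisets_of_size W (Suc d) \<and> card Y = card X \<and>
        card (shadow Y) \<le> card (shadow X)" for Y
      have "P X" using X by (simp add: P_def)
      then obtain Y where Y: "P Y" "\<And>Y'. P Y' \<Longrightarrow> sum f Y \<le> sum f Y'"
        using ex_has_least_nat[of P X "sum f"] by blast
      have Ysub: "Y \<subseteq> multisets_of_size W (Suc d)" using Y(1) by (simp add: P_def)
      have compressed: "initial_segment V (Suc d - size u) (fibre V Y u)"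
        if "V \<subseteq> W" "V \<noteq> {}" "macaulay V" "u \<in> outer (W - V) (Suc d)" for V u
      proof (rule ccontr)
        assume "\<not> ?thesis"
        from compression_step[OF less.prems that(1,2,3) Ysub that(4) this, of f] f_mono
        obtain Y' where "Y' \<subseteq> multisets_of_size W (Suc d)" "card Y' = card Y"
          "card (shadow Y') \<le> card (shadow Y)" "sum f Y' < sum f Y" by blast
        then show False using Y(1) Y(2)[of Y'] unfolding P_def by force
      qed
      have stable: "add_mset z M \<in> Y" if M: "add_mset x M \<in> Y" for x M
      proof (cases "x = z")
        case False
        have "add_mset x M \<in> multisets_of_size W (Suc d)" using M Ysub by blast
        then have xM: "x \<in> W" "set_mset M \<subseteq> W" "size M = d"
          by (auto simp: multisets_of_size_def)
        define u where "u = filter_mset (\<lambda>p. p \<notin> {z, x}) M"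
        define w where "w = filter_mset (\<lambda>p. p \<in> {z, x}) M"
        have M_eq: "M = u + w"
          using multiset_partition[of M "\<lambda>p. p \<in> {z, x}"] by (simp add: u_def w_def add.commute)
        have su: "size u + size w = d" using xM(3) by (simp add: M_eq)
        have "macaulay {z, x}" using macaulay_pair[of z x] z xM False by (simp add: le_neq_implies_less)
        moreover have "u \<in> outer (W - {z, x}) (Suc d)"
          using xM su by (auto simp: outer_iff u_def)
        ultimately have seg: "initial_segment {z, x} (Suc d - size u) (fibre {z, x} Y u)"
          using compressed[of "{z, x}" u] z xM by simp
        have w: "set_mset w \<subseteq> {z, x}" by (auto simp: w_def)
        have "add_mset x w \<in> fibre {z, x} Y u" using M w by (auto simp: fibre_def M_eq)
        moreover have "Suc d - size u = Suc (size w)" using su by simp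
        ultimately have "add_mset z w \<in> fibre {z, x} Y u"
          using initial_segment_stable[of "{z, x}" "size w" _ z x w] seg z xM by auto
        then show ?thesis by (simp add: fibre_def M_eq)
      qed (use M in simp)
      define T0 where "T0 = {M \<in> Y. z \<notin># M}"
      define S0 where "S0 = {M \<in> S. z \<notin># M}"
      have fin: "finite Y" "finite S"
        using Ysub S less.prems finite_subset_multisets_of_size unfolding initial_segment_def by blast+
      have "T0 \<subseteq> S0"
      proof (cases "T0 = {}")
        case False
        define B where "B = Max T0"
        have B: "B \<in> T0" "\<And>M. M \<in> T0 \<Longrightarrow> M \<le> B" 
          using False fin Max_in[of T0] Max_ge[of T0] by (auto simp: B_def T0_def)
        have BW: "B \<in> multisets_of_size W (Suc d)" using B Ysub by (auto simp: T0_def)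
        have seg0: "initial_segment (W - {z}) (Suc d) (fibre (W - {z}) Y {#})"
          using compressed[of "W - {z}" "{#}"] card_V mac_V by (simp add: outer_iff Diff_subset)
        have swap: "replicate_mset k z + u \<in> Y" if "replicate_mset k y + u \<in> Y" for k u
          using that
        proof (induction k arbitrary: u)
          case (Suc k)
          then have "replicate_mset k y + add_mset z u \<in> Y"
            using stable[of y "replicate_mset k y + u"] by simp
          from Suc.IH[OF this] show ?case by simp
        qed simp
        have below_B: "A \<in> Y" if A: "A \<in> multisets_of_size W (Suc d)" "A \<le> B" for A
        proof -
          define k where "k = count A z"
          define u where "u = filter_mset (\<lambda>p. p \<noteq> z) A"
          have A_eq: "A = replicate_mset k z + u"
            unfolding k_def u_def by (rule multiset_eqI) simp
          have "size A = k + size u" unfolding A_eq by simp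
          then have sizes: "k + size u = Suc d" "set_mset u \<subseteq> W - {z}"
            using A(1) by (auto simp: multisets_of_size_def u_def)
          have Bz: "set_mset B \<subseteq> W - {z}" "size B = Suc d"
            using BW B(1) by (auto simp: multisets_of_size_def T0_def)
          have le: "replicate_mset k y + u \<le> B"
          proof (rule replace_least_le[OF _ _ \<open>z < y\<close>])
            show "replicate_mset k z + u \<le> B" using A(2) A_eq by simp
            show "size B = k + size u" using sizes(1) Bz(2) by simp
            show "y \<le> p" if "p \<in># u + B" for p
              using that sizes(2) Bz(1) by (intro y(3)) auto
          qed
          have "B \<in> fibre (W - {z}) Y {#}" using B(1) Bz by (simp add: fibre_def T0_def)
          moreover have "replicate_mset k y + u \<in> multisets_of_size (W - {z}) (Suc d)"
            using sizes y by (auto simp: multisets_of_size_def)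
          ultimately have "replicate_mset k y + u \<in> fibre (W - {z}) Y {#}"
            using seg0 le unfolding initial_segment_def by (metis order_le_less)
          then show "A \<in> Y" using swap[of k u] by (simp add: fibre_def A_eq)
        qed
        define L where "L = {A \<in> multisets_of_size W (Suc d). A \<le> B}"
        have "initial_segment W (Suc d) L" by (auto simp: initial_segment_def L_def)
        moreover have "card L \<le> card S"
          using below_B fin Y(1) card card_mono[of Y L] by (auto simp: L_def P_def)
        ultimately have "L \<subseteq> S" using initial_segment_subset_card less.prems S by blast
        then show ?thesis using B Ysub by (auto simp: T0_def S0_def L_def)
      qed (simp add: S0_def)
      then have le: "card T0 \<le> card S0" using fin by (intro card_mono) (auto simp: S0_def)
      have split: "card {M \<in> Z. z \<in># M} + card {M \<in> Z. z \<notin># M} = card Z" if "finite Z" for Z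
        using that by (subst card_Un_disjoint[symmetric]) (auto intro: arg_cong[of _ _ card])
      have "card (shadow S) = card {M \<in> S. z \<in># M}"
        by (rule card_stable_shadow[OF initial_segment_stable[OF S]]) (use z in auto)
      moreover have "card (shadow Y) = card {M \<in> Y. z \<in># M}"
        by (rule card_stable_shadow) (rule stable)
      ultimately have "card (shadow S) \<le> card (shadow Y)"
        using split[OF fin(1)] split[OF fin(2)] le card Y(1) unfolding T0_def S0_def P_def by linarith
      then show "card (shadow S) \<le> card (shadow X)" using Y(1) by (simp add: P_def)
    qed
  qed
qed

section \<open>Binomial expansions count shadows\<close>

lemma replicate_mset_least:
  fixes x :: nat
  assumes "size N = k" "\<And>p. p \<in># N \<Longrightarrow> x \<le> p"
  shows "replicate_mset k x \<le> N"
  using assms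
proof (induction N arbitrary: k)
  case (add p N)
  then show ?case by (auto intro!: add_mset_le_le_le)
qed simp

lemma replicate_mset_greatest:
  fixes x :: nat
  assumes "size N = k" "\<And>p. p \<in># N \<Longrightarrow> p \<le> x"
  shows "N \<le> replicate_mset k x"
  using assms
proof (induction N arbitrary: k)
  case (add p N)
  then show ?case by (auto intro!: add_mset_le_le_le)
qed simp

text \<open>
  Recursion for counting the predecessors of a multiset with largest element \<open>y\<close>: a predecessor
  either avoids \<open>y\<close> and everything above, or contains \<open>y\<close>, which can then be cancelled on both sides.
\<close>

lemma below_add_mset:
  fixes M :: "nat multiset"
  assumes "\<And>x. x \<in># M \<Longrightarrow> x \<le> y"
  shows "{N. size N = Suc d \<and> N < add_mset y M} =
    multisets_of_size {..<y} (Suc d) \<union> add_mset y ` {N. size N = d \<and> N < M}" (is "?L = ?R")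
proof (intro equalityI subsetI)
  fix N assume N: "N \<in> ?L"
  show "N \<in> ?R"
  proof (cases "set_mset N \<subseteq> {..<y}")
    case True
    then show ?thesis using N by (auto simp: multisets_of_size_def)
  next
    case False
    then obtain x where "x \<in># N" "x \<notin> {..<y}" by blast
    then have x: "x \<in># N" "y \<le> x" by auto
    have "y \<in># N"
    proof (rule ccontr)
      assume "y \<notin># N"
      then have "y < x" using x by (metis le_neq_implies_less)
      have "z < x" if "z \<in># add_mset y M" for z
        using that assms[of z] \<open>y < x\<close> by auto
      then have "add_mset y M < N" using x(1) ex_gt_imp_less_multiset by blast
      then show False using N by (auto dest: order_less_asym)
    qed
    then obtain N' where "N = add_mset y N'" by (metis multi_member_split)
    then show ?thesis using N by auto
  qed
next
  fix N assume "N \<in> ?R"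
  then show "N \<in> ?L"
  proof
    assume "N \<in> multisets_of_size {..<y} (Suc d)"
    then show ?thesis
      by (auto simp: multisets_of_size_def intro!: ex_gt_imp_less_multiset bexI[of _ y])
  qed auto
qed

lemma multisets_of_size_containing:
  assumes "x \<in> W"
  shows "{N \<in> multisets_of_size W (Suc d). x \<in># N} = add_mset x ` multisets_of_size W d"
proof (intro equalityI subsetI)
  fix N assume N: "N \<in> {N \<in> multisets_of_size W (Suc d). x \<in># N}"
  then obtain N' where N': "N = add_mset x N'" by (auto dest: multi_member_split)
  have "set_mset N \<subseteq> W" "size N = Suc d" using N by (auto simp: multisets_of_size_def)
  then show "N \<in> add_mset x ` multisets_of_size W d"
    unfolding N' by (auto simp: multisets_of_size_def)
qed (use assms in \<open>auto simp: multisets_of_size_def\<close>)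

lemma count_below_add_mset:
  fixes M :: "nat multiset"
  assumes "\<And>x. x \<in># M \<Longrightarrow> x \<le> y" "0 < y" "finite {N. size N = d \<and> N < M}"
  shows "finite {N. size N = Suc d \<and> N < add_mset y M}"
    and "card {N. size N = Suc d \<and> N < add_mset y M} =
           ((y + d) choose Suc d) + card {N. size N = d \<and> N < M}"
    and "card {N. size N = Suc d \<and> N < add_mset y M \<and> 0 \<in># N} =
           ((y + d - 1) choose d) + card {N. size N = d \<and> N < M \<and> 0 \<in># N}"
proof -
  have split: "{N. size N = Suc d \<and> N < add_mset y M} =
      multisets_of_size {..<y} (Suc d) \<union> add_mset y ` {N. size N = d \<and> N < M}"
    by (rule below_add_mset) (rule assms(1))
  let ?B = "{N. size N = d \<and> N < M}" and ?Z = "{N. size N = d \<and> N < M \<and> 0 \<in># N}"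
  have inj: "inj_on (add_mset x) A" for x :: nat and A by (auto simp: inj_on_def)
  show "finite {N. size N = Suc d \<and> N < add_mset y M}"
    unfolding split using assms(3) by (simp add: finite_multisets_of_size)
  have disj: "multisets_of_size {..<y} (Suc d) \<inter> add_mset y ` A = {}" for A
    by (auto simp: multisets_of_size_def)
  have full: "finite (multisets_of_size {..<y} (Suc d))"
    "card (multisets_of_size {..<y} (Suc d)) = ((y + d) choose Suc d)"
    by (simp_all add: finite_multisets_of_size card_multisets_of_size)
  show "card {N. size N = Suc d \<and> N < add_mset y M} =
      ((y + d) choose Suc d) + card {N. size N = d \<and> N < M}"
    unfolding split card_Un_disjoint[OF full(1) finite_imageI[OF assms(3)] disj]
    by (simp only: full(2) card_image[OF inj])
  have eq: "{N. size N = Suc d \<and> N < add_mset y M \<and> 0 \<in># N} =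
      {N \<in> multisets_of_size {..<y} (Suc d). 0 \<in># N} \<union> add_mset y ` ?Z" (is "?X = _")
  proof (rule Set.set_eqI)
    fix N
    have "N \<in> ?X \<longleftrightarrow>
        N \<in> multisets_of_size {..<y} (Suc d) \<union> add_mset y ` ?B \<and> 0 \<in># N"
      unfolding split[symmetric] by blast
    then show "N \<in> ?X \<longleftrightarrow>
        N \<in> {N \<in> multisets_of_size {..<y} (Suc d). 0 \<in># N} \<union> add_mset y ` ?Z"
      using assms(2) by auto
  qed
  have fin0: "finite ?Z" by (rule finite_subset[OF _ assms(3)]) auto
  have "card ?X = card {N \<in> multisets_of_size {..<y} (Suc d). 0 \<in># N} + card (add_mset y ` ?Z)"
    unfolding eq using disj[of ?Z] full(1) fin0 by (intro card_Un_disjoint) auto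
  then show "card ?X = ((y + d - 1) choose d) + card ?Z"
    using multisets_of_size_containing[of 0 "{..<y}" d] assms(2)
    by (simp add: card_image inj card_multisets_of_size)
qed

text \<open>
  A binomial expansion encodes a monomial: \<open>M\<close> consists of the variables \<open>a l - l + 1\<close> for \<open>l\<close> from \<open>j\<close> to \<open>i\<close>
  together with \<open>j - 1\<close> copies of \<open>0\<close>. The binomials count the predecessors of \<open>M\<close>, sorted by the first
  position where they fall below \<open>M\<close>; the lowered binomials count those predecessors that contain \<open>0\<close>,
  which is the size of the shadow.
\<close>

lemma expansion_multiset:
  assumes "1 \<le> j" "j \<le> i" "j \<le> a j" "strict_mono_on {j..i} a"
  shows "i \<le> a i \<and> (\<exists>M. size M = i \<and> (\<forall>x\<in>#M. x \<le> a i - i + 1) \<and>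
    finite {N. size N = i \<and> N < M} \<and>
    card {N. size N = i \<and> N < M} = (\<Sum>l=j..i. a l choose l) \<and>
    card {N. size N = i \<and> N < M \<and> 0 \<in># N} = (\<Sum>l=j..i. (a l - 1) choose (l - 1)))"
  using assms(2,4)
proof (induction i rule: dec_induct)
  case base
  define d where "d = j - 1"
  have j: "j = Suc d" using assms(1) by (simp add: d_def)
  define y where "y = a j - j + 1"
  define Z where "Z = replicate_mset d (0::nat)"
  have none: "{N. size N = d \<and> N < Z} = {}"
    using replicate_mset_least[of _ d 0] by (auto simp: Z_def linorder_not_less[symmetric])
  have Z: "x \<le> y" if "x \<in># Z" for x using that by (auto simp: Z_def split: if_splits)
  have "0 < y" by (simp add: y_def)
  note count = count_below_add_mset[of Z y d, OF Z this, unfolded none]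
  have none0: "card {N. size N = d \<and> N < Z \<and> 0 \<in># N} = 0" using none by (simp add: card_eq_0_iff) blast
  have "y + d = a j" using assms(3) by (simp add: y_def j)
  then have "card {N. size N = j \<and> N < add_mset y Z} = (a j choose j)"
    "card {N. size N = j \<and> N < add_mset y Z \<and> 0 \<in># N} = (a j - 1 choose (j - 1))"
    using count(2,3) unfolding none0 by (simp_all add: j)
  moreover have "size (add_mset y Z) = j" by (simp add: Z_def j)
  moreover have "\<forall>x\<in>#add_mset y Z. x \<le> a j - j + 1" using Z by (auto simp: y_def)
  ultimately show ?case
    using assms(3) count(1) unfolding j[symmetric] by (intro conjI exI[of _ "add_mset y Z"]) simp_all
next
  case (step i)
  have "strict_mono_on {j..i} a" using step.prems by (auto simp: strict_mono_on_def)
  with step.IH obtain M where M: "i \<le> a i" "size M = i" "\<forall>x\<in>#M. x \<le> a i - i + 1"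
    "finite {N. size N = i \<and> N < M}" "card {N. size N = i \<and> N < M} = (\<Sum>l=j..i. a l choose l)"
    "card {N. size N = i \<and> N < M \<and> 0 \<in># N} = (\<Sum>l=j..i. (a l - 1) choose (l - 1))"
    by blast
  have lt: "a i < a (Suc i)" using step by (auto simp: strict_mono_on_def)
  define y where "y = a (Suc i) - i"
  have y: "0 < y" "y + i = a (Suc i)" "\<And>x. x \<in># M \<Longrightarrow> x \<le> y"
    using lt M(1,3) by (force simp: y_def)+
  note count = count_below_add_mset[of M y i, OF y(3,1) M(4)]
  show ?case
  proof (intro conjI exI[of _ "add_mset y M"])
    show "\<forall>x\<in>#add_mset y M. x \<le> a (Suc i) - Suc i + 1"
    proof -
      have "a (Suc i) - Suc i + 1 = y" using lt M(1) by (simp add: y_def)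
      then show ?thesis using y(3) by auto
    qed
  qed (use count M y lt step.hyps in auto)
qed

lemma binomial_unbounded:
  assumes "1 \<le> i"
  shows "n < (n + i) choose i"
proof (induction n)
  case (Suc n)
  obtain i' where "i = Suc i'" using assms by (cases i) auto
  then have "(Suc n + i) choose i = ((n + i) choose i) + ((n + i) choose i')" by simp
  moreover have "0 < (n + i) choose i'" using \<open>i = Suc i'\<close> by (simp add: zero_less_binomial)
  ultimately show ?case using Suc by linarith
qed simp

text \<open>
  The greedy algorithm: take the largest \<open>c\<close> with \<open>c choose i \<le> n\<close>. The remainder is less than
  \<open>c choose (i - 1)\<close> by Pascal's rule, so the next top is smaller than \<open>c\<close>. To have this available in
  the induction, the claim is strengthened by \<open>a i choose i \<le> n\<close>.
\<close>

lemma binomial_expansion_exists: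
  assumes "1 \<le> i" "0 < n"
  shows "\<exists>j a. binomial_expansion n i j a"
proof -
  have "\<exists>j a. binomial_expansion n i j a \<and> a i choose i \<le> n"
    using assms
  proof (induction i arbitrary: n rule: nat_induct_at_least)
    case base
    then show ?case
      by (intro exI[of _ 1] exI[of _ "\<lambda>_. n"]) (auto simp: binomial_expansion_def strict_mono_on_def)
  next
    case (Suc i)
    define m where "m = (LEAST m. n < m choose Suc i)"
    have "\<exists>m. n < m choose Suc i" using binomial_unbounded[of "Suc i" n] by (metis le_add1 plus_1_eq_Suc)
    then have m: "n < m choose Suc i" unfolding m_def by (rule LeastI_ex)
    have m_le: "m' choose Suc i \<le> n" if "m' < m" for m'
      using not_less_Least[of m' "\<lambda>m. n < m choose Suc i"] that unfolding m_def by auto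
    have "Suc i < m"
    proof (rule ccontr)
      assume "\<not> Suc i < m"
      then have "m choose Suc i \<le> Suc i choose Suc i" by (intro binomial_right_mono) auto
      then show False using m Suc.prems by simp
    qed
    then obtain c where c: "m = Suc c" "Suc i \<le> c" by (cases m) auto
    have c_le: "c choose Suc i \<le> n" using m_le c by simp
    show ?case
    proof (cases "c choose Suc i = n")
      case True
      then show ?thesis using c(2)
        by (intro exI[of _ "Suc i"] exI[of _ "\<lambda>_. c"]) (auto simp: binomial_expansion_def strict_mono_on_def)
    next
      case False
      define n' where "n' = n - (c choose Suc i)"
      have "0 < n'" "n' < c choose i" using False c_le m c by (auto simp: n'_def)
      then obtain j a where a: "binomial_expansion n' i j a" "a i choose i \<le> n'" using Suc.IH by blast
      have "a i < c"
      proof (rule ccontr)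
        assume "\<not> a i < c"
        then have "c choose i \<le> a i choose i" by (intro binomial_right_mono) auto
        then show False using a(2) \<open>n' < c choose i\<close> by simp
      qed
      have ji: "j \<le> i" using a(1) by (simp add: binomial_expansion_def)
      have mono: "a l \<le> a i" if "l \<in> {j..i}" for l
        using a(1) that strict_mono_on_leD[of "{j..i}" a l i] by (auto simp: binomial_expansion_def)
      have "strict_mono_on {j..Suc i} (a(Suc i := c))"
        unfolding strict_mono_on_def
      proof (intro allI impI)
        fix k l assume kl: "k \<in> {j..Suc i} \<and> l \<in> {j..Suc i} \<and> k < l"
        show "(a(Suc i := c)) k < (a(Suc i := c)) l"
        proof (cases "l = Suc i")
          case True
          then show ?thesis using mono[of k] kl \<open>a i < c\<close> by auto
        next
          case False
          then show ?thesis using a(1) kl by (auto simp: binomial_expansion_def strict_mono_on_def)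
        qed
      qed
      moreover have "(\<Sum>l=j..Suc i. (a(Suc i := c)) l choose l) = n' + (c choose Suc i)"
        using a(1) ji by (simp add: binomial_expansion_def)
      ultimately have "binomial_expansion n (Suc i) j (a(Suc i := c))"
        using a(1) ji c_le by (auto simp: binomial_expansion_def n'_def)
      moreover have "(a(Suc i := c)) (Suc i) choose Suc i \<le> n" using c_le by simp
      ultimately show ?thesis by blast
    qed
  qed
  then show ?thesis by blast
qed

lemma less_multiset_bounded:
  fixes A B :: "nat multiset"
  assumes "B \<le> A" "set_mset A \<subseteq> {..<r}"
  shows "set_mset B \<subseteq> {..<r}"
proof
  fix x assume x: "x \<in># B"
  show "x \<in> {..<r}"
  proof (rule ccontr)
    assume "x \<notin> {..<r}"
    then have "\<forall>p. p \<in># A \<longrightarrow> p < x" using assms(2) by fastforce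
    then have "A < B" using x ex_gt_imp_less_multiset by blast
    then show False using assms(1) by simp
  qed
qed

text \<open>
  Any expansion of \<open>card S\<close> encodes a monomial with exactly \<open>card S\<close> predecessors, so \<open>S\<close> is the set of
  these predecessors. Therefore every expansion yields the same lowered sum, and the
  definite description in \<open>lower_shift\<close> is justified without a separate uniqueness proof.
\<close>

lemma lower_shift_initial_segment:
  assumes S: "initial_segment {..<r} (Suc d) S" "S \<noteq> {}"
  shows "lower_shift (card S) (Suc d) = card (shadow S)"
proof -
  obtain A where A: "A \<in> S" using S by auto
  have "A \<in> multisets_of_size {..<r} (Suc d)" using A S by (auto simp: initial_segment_def)
  then have "0 < r" by (cases r) (auto simp: multisets_of_size_def)
  have S_sub: "S \<subseteq> multisets_of_size {..<r} (Suc d)" using S by (simp add: initial_segment_def)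
  have fin: "finite S" by (rule finite_subset_multisets_of_size[OF _ S_sub]) simp
  have shadow_S: "card (shadow S) = card {N \<in> S. 0 \<in># N}"
    by (rule card_stable_shadow[OF initial_segment_stable[OF S(1)]]) (use \<open>0 < r\<close> in auto)
  have lowered: "(\<Sum>l=j..Suc d. (a l - 1) choose (l - 1)) = card (shadow S)"
    if exp: "binomial_expansion (card S) (Suc d) j a" for j a
  proof -
    have "1 \<le> j" "j \<le> Suc d" "j \<le> a j" "strict_mono_on {j..Suc d} a"
      using exp by (simp_all add: binomial_expansion_def)
    from expansion_multiset[OF this] obtain M :: "nat multiset" where M:
      "finite {N. size N = Suc d \<and> N < M}"
      "card {N. size N = Suc d \<and> N < M} = (\<Sum>l=j..Suc d. a l choose l)"
      "card {N. size N = Suc d \<and> N < M \<and> 0 \<in># N} = (\<Sum>l=j..Suc d. (a l - 1) choose (l - 1))"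
      by blast
    define L where "L = {N. size N = Suc d \<and> N < M}"
    have "S \<subseteq> L \<or> L \<subseteq> S"
    proof (rule ccontr)
      assume "\<not> ?thesis"
      then obtain B C where BC: "B \<in> S" "B \<notin> L" "C \<in> L" "C \<notin> S" by blast
      have B: "set_mset B \<subseteq> {..<r}" "size B = Suc d"
        using BC S_sub by (auto simp: multisets_of_size_def)
      then have "C < B" using BC by (auto simp: L_def)
      then have "C \<in> multisets_of_size {..<r} (Suc d)"
        using less_multiset_bounded[of C B r] B BC by (auto simp: L_def multisets_of_size_def)
      then show False using S(1) BC \<open>C < B\<close> by (auto simp: initial_segment_def)
    qed
    moreover have "card L = card S" using M(2) exp by (simp add: L_def binomial_expansion_def)
    ultimately have "S = L" using fin M(1) unfolding L_def[symmetric] by (metis card_subset_eq)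
    then have "{N \<in> S. 0 \<in># N} = {N. size N = Suc d \<and> N < M \<and> 0 \<in># N}" by (auto simp: L_def)
    then show ?thesis using M(3) shadow_S by simp
  qed
  obtain j a where exp: "binomial_expansion (card S) (Suc d) j a"
    using binomial_expansion_exists[of "Suc d" "card S"] S(2) fin by (auto simp: card_gt_0_iff)
  show ?thesis unfolding lower_shift_def
  proof (rule the_equality)
    show "\<exists>j a. binomial_expansion (card S) (Suc d) j a \<and>
        card (shadow S) = (\<Sum>l=j..Suc d. (a l - 1) choose (l - 1))"
      using exp lowered[OF exp] by metis
  qed (use lowered in metis)
qed

section \<open>Exchanges in lexicographic order ideals\<close>

text \<open>
  A set of monomials that is closed under division, given degree by degree.
\<close>

definition order_sequence :: "nat \<Rightarrow> (nat \<Rightarrow> nat multiset set) \<Rightarrow> bool" where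
  "order_sequence r M \<longleftrightarrow>
     (\<forall>d. M d \<subseteq> multisets_of_size {..<r} d \<and> shadow (M (Suc d)) \<subseteq> M d)"

lemma order_sequence_finite:
  assumes "order_sequence r M"
  shows "finite (M d)"
  using assms finite_subset_multisets_of_size[of "{..<r}" "M d" d] by (auto simp: order_sequence_def)

lemma order_sequence_update:
  assumes "order_sequence r M" "K \<subseteq> multisets_of_size {..<r} (Suc i)"
    "shadow (M (Suc (Suc i))) \<subseteq> K" "shadow K \<subseteq> M i"
  shows "order_sequence r (M(Suc i := K))"
  using assms by (auto simp: order_sequence_def)

text \<open>
  No multiset of the same size lies strictly between \<open>add_mset 0 M\<close> and \<open>add_mset 1 M\<close>. After
  cancelling the common part, \<open>B\<close> contains an element above all of \<open>A\<close>. That element cannot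
  exceed \<open>1\<close>, so that \<open>A\<close> consists of zeros, and nothing is left between.
\<close>

lemma adjacent_multiset:
  fixes M N :: "nat multiset"
  assumes "add_mset 0 M < N" "size N = Suc (size M)"
  shows "add_mset 1 M \<le> N"
proof (rule ccontr)
  assume "\<not> ?thesis"
  then have lt: "N < add_mset 1 M" by simp
  define A B C where "A = M - N" and "B = N - M" and "C = M \<inter># N"
  have M_eq: "M = A + C" and N_eq: "N = B + C"
    unfolding A_def B_def C_def by (rule multiset_eqI, simp)+
  have "add_mset 0 A + C < B + C" "B + C < add_mset 1 A + C" using assms(1) lt M_eq N_eq by simp_all
  then have low: "add_mset 0 A < B" and up: "B < add_mset 1 A"
    by (simp_all only: add_less_cancel_right)
  have size: "size B = Suc (size A)" using assms(2) by (simp add: M_eq N_eq)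
  obtain b where b: "b \<in># B" "\<forall>y\<in>#A. y < b"
  proof (cases "A = {#}")
    case True
    have "B \<noteq> {#}" using size by auto
    then show ?thesis using True that by auto
  next
    case False
    define a where "a = Max (set_mset A)"
    have a: "a \<in># A" "\<forall>y\<in>#A. y \<le> a" using False by (simp_all add: a_def)
    have "A < B" using low by (rule order_less_trans[rotated]) simp
    then have "\<not> (\<forall>x. x \<in># B \<longrightarrow> x < a)"
      using a(1) ex_gt_imp_less_multiset[of A B] by (metis order_less_asym)
    then obtain b where "b \<in># B" "a \<le> b" by (auto simp: linorder_not_less)
    moreover have "a \<notin># B" using a(1) by (auto simp: A_def B_def in_diff_count)
    ultimately show ?thesis using a(2) that by (metis order_le_less order_le_less_trans)
  qed
  have "\<not> 1 < b"
  proof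
    assume "1 < b"
    then have "add_mset 1 A < B" using b by (intro ex_gt_imp_less_multiset) auto
    then show False using up by simp
  qed
  then consider "b = 0" | "b = 1" by linarith
  then show False
  proof cases
    case 1
    then have "A = {#}" using b(2) by (cases A) auto
    moreover obtain B' where "B = add_mset 0 B'" using b(1) 1 by (metis multi_member_split)
    then have "B = {#0#}" using size \<open>A = {#}\<close> by simp
    ultimately show False using low by simp
  next
    case 2
    obtain B' where B': "B = add_mset 1 B'" using b(1) 2 by (metis multi_member_split)
    have "set_mset A \<subseteq> {0}" using b(2) 2 by auto
    then have "A = replicate_mset (size A) 0" by (rule set_mset_subset_singletonD)
    moreover have "replicate_mset (size A) 0 \<le> B'"
      using size B' by (intro replicate_mset_least) auto
    moreover have "B' < A" using up B' by simp
    ultimately show False by (metis linorder_not_le)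
  qed
qed

lemma shadow_Un: "shadow (A \<union> B) = shadow A \<union> shadow B"
  by (auto simp: shadow_def)

lemma initial_segment_remove_Max:
  assumes "initial_segment W d S" "finite S" "S \<noteq> {}"
  shows "initial_segment W d (S - {Max S})"
  unfolding initial_segment_def
proof (intro conjI ballI impI)
  show "S - {Max S} \<subseteq> multisets_of_size W d" using assms(1) by (auto simp: initial_segment_def)
  fix A B assume AB: "A \<in> S - {Max S}" "B \<in> multisets_of_size W d" "B < A"
  then have "B \<in> S" using assms(1) by (auto simp: initial_segment_def)
  moreover have "A \<le> Max S" using AB(1) assms(2) by simp
  ultimately show "B \<in> S - {Max S}" using AB(3) by auto
qed

lemma initial_segment_shadow_eq:
  assumes "initial_segment {..<r} (Suc d) S" "0 < r"
  shows "shadow S = {M. add_mset 0 M \<in> S}"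
  by (rule stable_shadow[OF initial_segment_stable[OF assms(1)]]) (use assms(2) in auto)

text \<open>
  The monomials outside a lexsegment ideal.
\<close>

locale lex_sequence =
  fixes r :: nat and L :: "nat \<Rightarrow> nat multiset set"
  assumes r_pos: "0 < r"
    and order: "order_sequence r L"
    and initial: "initial_segment {..<r} d (L d)"
begin

lemma finite_L: "finite (L d)"
  using order_sequence_finite[OF order] .

lemma L_subset: "L d \<subseteq> multisets_of_size {..<r} d"
  using order by (simp add: order_sequence_def)

lemma shadow_L_subset: "shadow (L (Suc d)) \<subseteq> L d"
  using order by (simp add: order_sequence_def)

lemma shadow_L: "shadow (L (Suc d)) = {M. add_mset 0 M \<in> L (Suc d)}"
  using initial_segment_shadow_eq[OF initial r_pos] .

lemma initial_shadow_L: "initial_segment {..<r} d (shadow (L (Suc d)))"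
  by (rule initial_segment_shadow[OF initial, of 0]) (use r_pos in auto)

lemma initialD: "A \<in> L d \<Longrightarrow> B \<in> multisets_of_size {..<r} d \<Longrightarrow> B \<le> A \<Longrightarrow> B \<in> L d"
  using initial[of d] unfolding initial_segment_def by (metis order_le_less)

text \<open>
  The shadow is itself a segment, so if it is proper, it misses the largest element. This is why that
  element may be exchanged without disturbing the next degree.
\<close>

lemma shadow_without_Max:
  assumes "shadow (L (Suc d)) \<noteq> L d"
  shows "L d \<noteq> {}" "Max (L d) \<in> L d" "Max (L d) \<notin> shadow (L (Suc d))"
proof -
  show ne: "L d \<noteq> {}" using assms shadow_L_subset[of d] by auto
  show "Max (L d) \<in> L d" using Max_in[OF finite_L ne] .
  show "Max (L d) \<notin> shadow (L (Suc d))"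
  proof
    assume max: "Max (L d) \<in> shadow (L (Suc d))"
    have "A \<in> shadow (L (Suc d))" if "A \<in> L d" for A
    proof -
      have "A \<le> Max (L d)" using that finite_L by simp
      then show ?thesis using max initial_shadow_L[of d] that L_subset[of d]
        unfolding initial_segment_def by (metis order_le_less subsetD)
    qed
    then show False using assms shadow_L_subset by blast
  qed
qed

lemma card_shadow_less:
  assumes "shadow (L (Suc d)) \<noteq> L d"
  shows "card (shadow (L (Suc d))) < card (L d)"
  using assms shadow_L_subset finite_L by (simp add: psubset_card_mono psubset_eq)

lemma add_zero_mem:
  assumes "F \<in> multisets_of_size {..<r} d"
  shows "add_mset 0 F \<in> multisets_of_size {..<r} (Suc d)"
  using assms r_pos by (auto simp: multisets_of_size_def)

lemma add_one_mem:
  assumes "add_mset 0 M < N" "N \<in> multisets_of_size {..<r} (Suc d)" "size M = d"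
  shows "add_mset 1 M \<le> N" "add_mset 1 M \<in> multisets_of_size {..<r} (Suc d)"
proof -
  show le: "add_mset 1 M \<le> N"
    using assms by (intro adjacent_multiset) (auto simp: multisets_of_size_def)
  show "add_mset 1 M \<in> multisets_of_size {..<r} (Suc d)"
    using less_multiset_bounded[OF le, of r] assms by (auto simp: multisets_of_size_def)
qed

text \<open>
  Let \<open>c\<close> be the largest monomial of \<open>L (i + 1)\<close> and \<open>b\<close> its successor. Adding \<open>b\<close> enlarges the shadow by
  assumption. Removing \<open>c\<close> afterwards loses nothing: if \<open>c = add_mset 0 m\<close>, then by adjacency
  \<open>add_mset 1 m\<close> is at most \<open>b\<close>, and so \<open>m\<close> is still in the shadow. The gap in degree \<open>i\<close> accommodates
  the new shadow, and the gap in degree \<open>i + 1\<close> allows \<open>c\<close> to be removed.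
\<close>

lemma exchange_Max_next:
  assumes full: "L (Suc i) \<noteq> multisets_of_size {..<r} (Suc i)"
    and gap: "shadow (L (Suc i)) \<noteq> L i" and gap': "shadow (L (Suc (Suc i))) \<noteq> L (Suc i)"
  defines "b \<equiv> Min (multisets_of_size {..<r} (Suc i) - L (Suc i))"
  assumes grow: "card (shadow (L (Suc i))) < card (shadow (insert b (L (Suc i))))"
  shows "\<exists>K. order_sequence r (L(Suc i := K)) \<and> card K = card (L (Suc i)) \<and>
    card (shadow (L (Suc i))) < card (shadow K)"
proof -
  define S where "S = insert b (L (Suc i))"
  note ins = initial_segment_insert_Min[OF finite_lessThan initial full, folded b_def]
  have S: "initial_segment {..<r} (Suc i) S" using ins(1) by (simp add: S_def)
  define c where "c = Max (L (Suc i))"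
  note c = shadow_without_Max[OF gap', folded c_def]
  define K where "K = S - {c}"
  have "b \<noteq> c" using c(2) ins(3) by auto
  have card_K: "card K = card (L (Suc i))"
    using ins(3) card_Suc_Diff1[of S c] c(2) finite_L[of "Suc i"] by (simp add: K_def S_def)
  have "c < b"
    using initialD[OF c(2) ins(2)] ins(3) by (metis linorder_not_less)
  note shadow_S = initial_segment_shadow_eq[OF S r_pos]
  have "shadow S \<subseteq> shadow K"
  proof
    fix m assume "m \<in> shadow S"
    then have m: "add_mset 0 m \<in> S" by (simp add: shadow_S)
    show "m \<in> shadow K"
    proof (cases "add_mset 0 m = c")
      case False
      then show ?thesis using m by (auto simp: shadow_def K_def)
    next
      case True
      have "size m = i" using True c(2) L_subset[of "Suc i"] by (auto simp: multisets_of_size_def)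
      then have "add_mset 1 m \<le> b" "add_mset 1 m \<in> multisets_of_size {..<r} (Suc i)"
        using add_one_mem[of m b i] True \<open>c < b\<close> ins(2) by auto
      then have "add_mset 1 m \<in> S"
        using S unfolding initial_segment_def S_def by (metis insertI1 order_le_less)
      then have "add_mset 1 m \<in> K" using True by (auto simp: K_def)
      then show ?thesis by (auto simp: shadow_def)
    qed
  qed
  moreover have "shadow K \<subseteq> shadow S" by (rule shadow_mono) (auto simp: K_def)
  ultimately have shadow_K: "shadow K = shadow S" by auto
  have S_L: "shadow S \<subseteq> insert (b - {#0#}) (shadow (L (Suc i)))"
    unfolding shadow_S shadow_L by (auto simp: S_def)
  have "shadow S \<subseteq> L i"
  proof (rule initial_segment_subset_card[OF finite_lessThan _ initial])
    show "initial_segment {..<r} i (shadow S)"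
      by (rule initial_segment_shadow[OF S, of 0]) (use r_pos in auto)
    have "card (shadow S) \<le> Suc (card (shadow (L (Suc i))))"
    proof -
      have fin: "finite (shadow (L (Suc i)))" by (rule finite_shadow[OF finite_L])
      show ?thesis
        using card_mono[OF finite.insertI[OF fin] S_L] card_insert_if[OF fin, of "b - {#0#}"]
        by (simp split: if_splits)
    qed
    then show "card (shadow S) \<le> card (L i)" using card_shadow_less[OF gap] by simp
  qed
  moreover have "K \<subseteq> multisets_of_size {..<r} (Suc i)"
    using ins(2) L_subset by (auto simp: K_def S_def)
  moreover have "shadow (L (Suc (Suc i))) \<subseteq> K"
    using shadow_L_subset c(3) by (auto simp: K_def S_def)
  ultimately have "order_sequence r (L(Suc i := K))"
    using order_sequence_update[OF order] shadow_K by simp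
  then show ?thesis using card_K grow shadow_K by (auto simp: S_def)
qed

text \<open>
  Let \<open>F\<close> be the smallest monomial of \<open>L i\<close> outside the shadow. The monomial \<open>add_mset 0 F\<close> brings \<open>F\<close> into the shadow,
  and its other quotients by variables are smaller than \<open>F\<close>, hence in \<open>L i\<close>.
  In exchange the smallest monomial \<open>add_mset 0 m\<close> with \<open>m = replicate_mset i 0\<close> is given up. This
  does not lose \<open>m\<close>, because the second smallest monomial \<open>add_mset 1 m\<close> belongs to the new set: it is in
  \<open>L (i + 1)\<close> unless this set has only one element, and then it is the added monomial.
\<close>

lemma exchange_Min_top:
  assumes gap: "shadow (L (Suc i)) \<noteq> L i" and ne: "L (Suc i) \<noteq> {}" and top: "L (Suc (Suc i)) = {}"
  shows "\<exists>K. order_sequence r (L(Suc i := K)) \<and> card K = card (L (Suc i)) \<and>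
    card (shadow (L (Suc i))) < card (shadow K)"
proof -
  have ne': "L i - shadow (L (Suc i)) \<noteq> {}" using gap shadow_L_subset[of i] by auto
  have fin': "finite (L i - shadow (L (Suc i)))" using finite_L by simp
  define F where "F = Min (L i - shadow (L (Suc i)))"
  have F: "F \<in> L i" "F \<notin> shadow (L (Suc i))"
    and F_least: "\<And>A. A \<in> L i \<Longrightarrow> A \<notin> shadow (L (Suc i)) \<Longrightarrow> F \<le> A"
    using Min_in[OF fin' ne'] Min_le[OF fin'] by (auto simp: F_def)
  have F_mem: "F \<in> multisets_of_size {..<r} i" using F(1) L_subset by blast
  define b where "b = add_mset 0 F"
  have b: "b \<in> multisets_of_size {..<r} (Suc i)" "b \<notin> L (Suc i)"
    using add_zero_mem[OF F_mem] F(2) by (auto simp: b_def shadow_L)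
  define m where "m = replicate_mset i (0::nat)"
  define z where "z = add_mset 0 m"
  have z_mem: "z \<in> multisets_of_size {..<r} (Suc i)"
    using r_pos by (auto simp: z_def m_def multisets_of_size_def split: if_splits)
  have z_le: "z \<le> N" if "size N = Suc i" for N
    using replicate_mset_least[of N "Suc i" 0] that by (simp add: z_def m_def)
  have "z \<in> L (Suc i)"
  proof -
    obtain N where N: "N \<in> L (Suc i)" using ne by auto
    then have "size N = Suc i" using L_subset[of "Suc i"] by (auto simp: multisets_of_size_def)
    then show ?thesis using initialD[OF N z_mem z_le] by simp
  qed
  then have m_shadow: "m \<in> shadow (L (Suc i))" by (simp add: shadow_L z_def)
  define K where "K = insert b (L (Suc i) - {z})"
  have card_K: "card K = card (L (Suc i))"
    using b(2) card_Suc_Diff1[OF finite_L \<open>z \<in> L (Suc i)\<close>] finite_L[of "Suc i"] by (simp add: K_def)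
  have shadow_b: "x \<in> L i" if "add_mset p x = b" for p x
  proof -
    have "add_mset 0 x \<le> add_mset p x" by (rule add_mset_le_left_le) simp
    then have "x \<le> F" using that by (simp add: b_def)
    moreover have "x \<in> multisets_of_size {..<r} i"
      using that b(1) by (auto simp: multisets_of_size_def)
    ultimately show ?thesis using initialD[OF F(1)] by blast
  qed
  have g: "add_mset 1 m \<in> K"
  proof (cases "L (Suc i) = {z}")
    case False
    then obtain N where N: "N \<in> L (Suc i)" "N \<noteq> z" using \<open>z \<in> L (Suc i)\<close> by blast
    have N_mem: "N \<in> multisets_of_size {..<r} (Suc i)" using N(1) L_subset by blast
    then have "z < N" using z_le[of N] N(2) by (simp add: multisets_of_size_def)
    then have "add_mset 1 m \<in> L (Suc i)"
      using add_one_mem[of m N i] N_mem initialD[OF N(1)] by (simp add: z_def m_def)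
    then show ?thesis by (simp add: K_def z_def)
  next
    case True
    then have shadow_m: "shadow (L (Suc i)) = {m}" unfolding shadow_L by (simp add: z_def)
    then have "F \<noteq> m" using F(2) by simp
    then obtain i' where i': "i = Suc i'"
      using F_mem by (cases i) (auto simp: m_def)
    define m' where "m' = replicate_mset i' (0::nat)"
    have m_eq: "m = add_mset 0 m'" by (simp add: m_def m'_def i')
    have "m \<le> F" using replicate_mset_least[of F i 0] F_mem by (simp add: m_def multisets_of_size_def)
    then have "add_mset 0 m' < F" using \<open>F \<noteq> m\<close> m_eq by simp
    then have le: "add_mset 1 m' \<le> F" and mem: "add_mset 1 m' \<in> multisets_of_size {..<r} i"
      using add_one_mem[of m' F i'] F_mem by (simp_all add: m'_def i')
    have "add_mset 1 m' \<in> L i" using initialD[OF F(1) mem le] .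
    moreover have "add_mset 1 m' \<notin> shadow (L (Suc i))" by (simp add: shadow_m m_eq)
    ultimately have "F = add_mset 1 m'" using F_least le by (simp add: antisym)
    then show ?thesis by (simp add: K_def b_def m_eq add_mset_commute)
  qed
  have "insert F (shadow (L (Suc i))) \<subseteq> shadow K"
  proof
    fix x assume "x \<in> insert F (shadow (L (Suc i)))"
    then consider "x = F" | "x = m" | "add_mset 0 x \<in> L (Suc i)" "x \<noteq> m" by (auto simp: shadow_L)
    then show "x \<in> shadow K"
      using g by cases (auto simp: shadow_def K_def b_def z_def)
  qed
  moreover have "shadow K \<subseteq> L i"
    using shadow_b shadow_L_subset[of i] by (auto simp: shadow_def K_def)
  moreover have "finite (shadow K)" using finite_L by (simp add: K_def finite_shadow)
  ultimately have "card (insert F (shadow (L (Suc i)))) \<le> card (shadow K)" by (intro card_mono)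
  then have "card (shadow (L (Suc i))) < card (shadow K)"
    using F(2) finite_shadow[OF finite_L] by simp
  moreover have "order_sequence r (L(Suc i := K))"
  proof (rule order_sequence_update[OF order])
    show "K \<subseteq> multisets_of_size {..<r} (Suc i)" using b L_subset by (auto simp: K_def)
    show "shadow (L (Suc (Suc i))) \<subseteq> K" by (simp add: top shadow_def)
  qed fact
  ultimately show ?thesis using card_K by blast
qed

text \<open>
  Removing the largest monomial \<open>c\<close> of \<open>L (k + 2)\<close> costs one element of the shadow if \<open>c\<close> contains \<open>0\<close>, and
  nothing otherwise. The monomial \<open>X\<close>, the pure power of the largest variable \<open>r - 1\<close>, is missing from \<open>L (k + 1)\<close>. In the
  second case, adding the next pure power contributes \<open>X\<close> to the shadow. In the first case,
  adding \<open>add_mset (r - 2) X\<close> contributes the two largest monomials of degree \<open>k + 1\<close>. Either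
  way the shadow has gained exactly one element and still fits into a set \<open>Y\<close> of the
  size of \<open>L (k + 1)\<close>. The shadow of \<open>Y\<close> is no obstacle, as \<open>L k\<close> is full.
\<close>

lemma exchange_Max_pure_power:
  assumes full: "L k = multisets_of_size {..<r} k"
    and not_full: "L (Suc k) \<noteq> multisets_of_size {..<r} (Suc k)"
    and gap: "shadow (L (Suc (Suc k))) \<noteq> L (Suc k)"
    and gap': "shadow (L (Suc (Suc (Suc k)))) \<noteq> L (Suc (Suc k))"
  shows "\<exists>Y K. order_sequence r (L(Suc k := Y, Suc (Suc k) := K)) \<and> card Y = card (L (Suc k)) \<and>
    card K = card (L (Suc (Suc k))) \<and> card (shadow (L (Suc (Suc k)))) < card (shadow K)"
proof -
  define X where "X = replicate_mset (Suc k) (r - 1)"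
  have X_max: "N \<le> X" if "N \<in> multisets_of_size {..<r} (Suc k)" for N
    unfolding X_def using that by (intro replicate_mset_greatest) (auto simp: multisets_of_size_def)
  have X_mem: "X \<in> multisets_of_size {..<r} (Suc k)"
    using r_pos by (auto simp: X_def multisets_of_size_def)
  have X: "X \<notin> L (Suc k)"
  proof
    assume "X \<in> L (Suc k)"
    then have "multisets_of_size {..<r} (Suc k) \<subseteq> L (Suc k)" using initialD X_max by blast
    then show False using not_full L_subset by blast
  qed
  then have X_shadow: "X \<notin> shadow (L (Suc (Suc k)))" using shadow_L_subset by blast
  define c where "c = Max (L (Suc (Suc k)))"
  note c = shadow_without_Max[OF gap', folded c_def]
  define K0 where "K0 = L (Suc (Suc k)) - {c}"
  have K0: "initial_segment {..<r} (Suc (Suc k)) K0"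
    unfolding K0_def c_def by (rule initial_segment_remove_Max[OF initial finite_L c(1)])
  note shadow_K0 = initial_segment_shadow_eq[OF K0 r_pos]
  have fin_shadow: "finite (shadow (L (Suc (Suc k))))" by (rule finite_shadow[OF finite_L])
  have "\<exists>G. G \<in> multisets_of_size {..<r} (Suc (Suc k)) \<and> G \<notin> L (Suc (Suc k)) \<and>
      card (shadow (insert G K0)) = Suc (card (shadow (L (Suc (Suc k)))))"
  proof (cases "0 \<in># c")
    case False
    define G where "G = add_mset (r - 1) X"
    have "shadow {G} = {X}"
    proof
      show "{X} \<subseteq> shadow {G}" by (auto simp: shadow_def G_def)
      show "shadow {G} \<subseteq> {X}"
      proof
        fix M assume "M \<in> shadow {G}"
        then obtain p where p: "add_mset p M = G" by (auto simp: shadow_def)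
        then have "p \<in># G" by (metis union_single_eq_member)
        then have "p = r - 1" by (auto simp: G_def X_def split: if_splits)
        then show "M \<in> {X}" using p by (simp add: G_def)
      qed
    qed
    moreover have "shadow K0 = shadow (L (Suc (Suc k)))"
      using False unfolding shadow_K0 shadow_L by (auto simp: K0_def)
    ultimately have "shadow (insert G K0) = insert X (shadow (L (Suc (Suc k))))"
      using shadow_Un[of "{G}" K0] by simp
    then have "card (shadow (insert G K0)) = Suc (card (shadow (L (Suc (Suc k)))))"
      using X_shadow fin_shadow by simp
    moreover have "G \<in> multisets_of_size {..<r} (Suc (Suc k))"
      using X_mem r_pos by (auto simp: G_def multisets_of_size_def)
    moreover have "G \<notin> L (Suc (Suc k))" using X_shadow by (auto simp: shadow_def G_def)
    ultimately show ?thesis by blast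
  next
    case True
    then obtain c' where c': "c = add_mset 0 c'" by (metis multi_member_split)
    have c'_shadow: "c' \<in> shadow (L (Suc (Suc k)))" using c(2) by (simp add: shadow_L c')
    then have c'_mem: "c' \<in> multisets_of_size {..<r} (Suc k)"
      using shadow_L_subset L_subset by blast
    have "c' \<noteq> X" using c'_shadow X_shadow by auto
    have "r \<noteq> 1"
    proof
      assume "r = 1"
      then have "set_mset c' \<subseteq> {0}" "size c' = Suc k"
        using c'_mem by (auto simp: multisets_of_size_def)
      then have "c' = X" using \<open>r = 1\<close> set_mset_subset_singletonD[of c' 0] by (simp add: X_def)
      then show False using \<open>c' \<noteq> X\<close> by simp
    qed
    define X' where "X' = add_mset (r - 2) (replicate_mset k (r - 1))"
    have "r - 2 \<noteq> r - 1" using \<open>r \<noteq> 1\<close> r_pos by simp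
    then have "X \<noteq> X'" by (auto simp: X_def X'_def)
    have X'_mem: "X' \<in> multisets_of_size {..<r} (Suc k)"
      using r_pos by (auto simp: X'_def multisets_of_size_def split: if_splits)
    have "c' \<le> X'"
    proof -
      obtain p where p: "p \<in># c'" "p \<noteq> r - 1"
      proof (rule ccontr)
        assume "\<not> thesis"
        then have "\<forall>p\<in>#c'. p = r - 1" using that by blast
        then have "set_mset c' \<subseteq> {r - 1}" by auto
        then have "c' = replicate_mset (size c') (r - 1)" by (rule set_mset_subset_singletonD)
        then show False using \<open>c' \<noteq> X\<close> c'_mem by (simp add: X_def multisets_of_size_def)
      qed
      then obtain c'' where c'': "c' = add_mset p c''" by (metis multi_member_split)
      have "p \<le> r - 2" "size c'' = k" "set_mset c'' \<subseteq> {..<r}"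
        using c'_mem p(2) by (auto simp: c'' multisets_of_size_def)
      then have "c'' \<le> replicate_mset k (r - 1)" by (intro replicate_mset_greatest) auto
      then show ?thesis using \<open>p \<le> r - 2\<close> by (simp add: c'' X'_def add_mset_le_le_le)
    qed
    define G where "G = add_mset (r - 2) X"
    have G_eq: "G = add_mset (r - 1) X'" by (simp add: G_def X_def X'_def add_mset_commute)
    have "shadow {G} = {X, X'}"
    proof
      show "{X, X'} \<subseteq> shadow {G}" using G_eq by (auto simp: shadow_def G_def)
      show "shadow {G} \<subseteq> {X, X'}"
      proof
        fix M assume "M \<in> shadow {G}"
        then obtain p where p: "add_mset p M = G" by (auto simp: shadow_def)
        then have "p \<in># G" by (metis union_single_eq_member)
        then have "p = r - 1 \<or> p = r - 2" by (auto simp: G_def X_def split: if_splits)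
        then show "M \<in> {X, X'}"
        proof
          assume "p = r - 1"
          then show ?thesis using p unfolding G_eq by simp
        next
          assume "p = r - 2"
          then show ?thesis using p by (simp add: G_def)
        qed
      qed
    qed
    moreover have shadow_K0': "shadow K0 = shadow (L (Suc (Suc k))) - {c'}"
      unfolding shadow_K0 shadow_L by (auto simp: K0_def c')
    moreover have "X' \<notin> shadow K0"
    proof
      assume X': "X' \<in> shadow K0"
      have "initial_segment {..<r} (Suc k) (shadow K0)"
        by (rule initial_segment_shadow[OF K0, of 0]) (use r_pos in auto)
      then have "c' \<in> shadow K0"
        using X' \<open>c' \<le> X'\<close> c'_mem unfolding initial_segment_def by (metis order_le_less)
      then show False by (simp add: shadow_K0')
    qed
    ultimately have "card (shadow (insert G K0)) = Suc (Suc (card (shadow K0)))"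
      using shadow_Un[of "{G}" K0] X_shadow \<open>X \<noteq> X'\<close> fin_shadow by simp
    moreover have "Suc (card (shadow K0)) = card (shadow (L (Suc (Suc k))))"
      unfolding shadow_K0' by (rule card_Suc_Diff1[OF fin_shadow c'_shadow])
    moreover have "G \<in> multisets_of_size {..<r} (Suc (Suc k))"
      using X_mem r_pos by (auto simp: G_def multisets_of_size_def)
    moreover have "G \<notin> L (Suc (Suc k))" using X_shadow by (auto simp: shadow_def G_def)
    ultimately show ?thesis by auto
  qed
  then obtain G where G: "G \<in> multisets_of_size {..<r} (Suc (Suc k))" "G \<notin> L (Suc (Suc k))"
    "card (shadow (insert G K0)) = Suc (card (shadow (L (Suc (Suc k)))))" by blast
  define K where "K = insert G K0"
  have K_sub: "K \<subseteq> multisets_of_size {..<r} (Suc (Suc k))"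
    using G(1) L_subset by (auto simp: K_def K0_def)
  have card_K: "card K = card (L (Suc (Suc k)))"
    using G(2) card_Suc_Diff1[OF finite_L c(2)] finite_L[of "Suc (Suc k)"] by (simp add: K_def K0_def)
  have "card (shadow K) \<le> card (L (Suc k))"
    using G(3) card_shadow_less[OF gap] by (simp add: K_def)
  then obtain Y where Y: "shadow K \<subseteq> Y" "Y \<subseteq> multisets_of_size {..<r} (Suc k)" "card Y = card (L (Suc k))"
    using exists_subset_between[of "shadow K" "card (L (Suc k))" "multisets_of_size {..<r} (Suc k)"]
      shadow_subset[OF K_sub] L_subset[of "Suc k"] by (auto simp: finite_multisets_of_size card_mono)
  have "shadow (L (Suc (Suc (Suc k)))) \<subseteq> K"
    using shadow_L_subset c(3) by (auto simp: K_def K0_def)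
  then have "order_sequence r (L(Suc k := Y, Suc (Suc k) := K))"
    using order Y K_sub shadow_subset[OF Y(2)] full by (auto simp: order_sequence_def)
  moreover have "card (shadow (L (Suc (Suc k)))) < card (shadow K)" using G(3) by (simp add: K_def)
  ultimately show ?thesis using Y(3) card_K by blast
qed

end

section \<open>Two order ideals with different shadows\<close>

text \<open>
  Minimality of the shadows of initial segments turns an order ideal into one made of initial segments.
\<close>

lemma macaulay_lex_sequence:
  assumes "order_sequence r B" "0 < r"
  obtains L where "lex_sequence r L" "\<And>d. card (L d) = card (B d)"
proof -
  have fin: "finite (multisets_of_size {..<r} d)" for d by (simp add: finite_multisets_of_size)
  have "card (B d) \<le> card (multisets_of_size {..<r} d)" for d
    using assms(1) card_mono[OF fin] by (auto simp: order_sequence_def)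
  then have "\<forall>d. \<exists>S. initial_segment {..<r} d S \<and> card S = card (B d)"
    using initial_segment_exists[of "{..<r}"] by auto
  then obtain L where L: "\<And>d. initial_segment {..<r} d (L d)" "\<And>d. card (L d) = card (B d)"
    by metis
  have "shadow (L (Suc d)) \<subseteq> L d" for d
  proof (rule initial_segment_subset_card[OF finite_lessThan _ L(1)])
    show "initial_segment {..<r} d (shadow (L (Suc d)))"
      by (rule initial_segment_shadow[OF L(1), of 0]) (use assms(2) in auto)
    have "card (shadow (L (Suc d))) \<le> card (shadow (B (Suc d)))"
    proof -
      have "macaulay {..<r}" by (rule macaulay_finite) simp
      moreover have "B (Suc d) \<subseteq> multisets_of_size {..<r} (Suc d)"
        using assms(1) by (simp add: order_sequence_def)
      moreover have "card (B (Suc d)) = card (L (Suc d))" by (simp add: L(2))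
      ultimately show ?thesis using L(1)[of "Suc d"] unfolding macaulay_def by blast
    qed
    also have "\<dots> \<le> card (B d)"
      using assms(1) by (intro card_mono order_sequence_finite[OF assms(1)]) (simp add: order_sequence_def)
    finally show "card (shadow (L (Suc d))) \<le> card (L d)" by (simp add: L(2))
  qed
  then have "lex_sequence r L"
    using L(1) assms(2) unfolding lex_sequence_def order_sequence_def initial_segment_def by blast
  then show ?thesis using that L(2) by blast
qed

text \<open>
  The combinatorial core. In each of the three cases, \<open>gap\<close> translates \<open>s d \<noteq> 0\<close> into the properness of
  the shadow of \<open>L (d + 1)\<close> in \<open>L d\<close>, and the corresponding exchange is applied.
\<close>

lemma two_order_sequences:
  fixes h :: "nat \<Rightarrow> nat" and s :: "nat \<Rightarrow> int"
  assumes B: "order_sequence r B" "\<And>d. card (B d) = h d" and r: "0 < r" "h 1 = r"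
    and e: "1 \<le> e" "h e \<noteq> 0" "\<forall>i>e. h i = 0"
    and s_0: "s 0 = 0"
    and s_e: "s e = int (h e)"
    and s_mid: "\<forall>i\<in>{1..<e}. s i = int (h i) - int (lower_shift (h (i + 1)) (i + 1))"
    and s_above: "\<forall>i>e. s i = 0"
    and t: "h t = (r - 1 + t) choose t" "\<forall>u>t. h u \<noteq> (r - 1 + u) choose u"
    and cond: "s (t + 1) * s (t + 2) \<noteq> 0
      \<or> (\<exists>i. s i * s (i + 1) \<noteq> 0
            \<and> lower_shift (h (i + 1) + 1) (i + 1) > lower_shift (h (i + 1)) (i + 1))
      \<or> s (e - 1) \<noteq> 0"
  obtains L M i where "order_sequence r L" "order_sequence r M" "\<And>d. card (L d) = h d" "\<And>d. card (M d) = h d"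
    "card (shadow (L (Suc i))) < card (shadow (M (Suc i)))"
proof -
  obtain L where lex: "lex_sequence r L" and "\<And>d. card (L d) = card (B d)"
    using macaulay_lex_sequence[OF B(1) r(1)] by blast
  then have card_L: "\<And>d. card (L d) = h d" using B(2) by simp
  interpret lex_sequence r L by (rule lex)
  have L_empty: "L d = {}" if "e < d" for d
    using card_L[of d] e(3) that finite_L[of d] by simp
  have full_iff: "L d = multisets_of_size {..<r} d \<longleftrightarrow> h d = (r - 1 + d) choose d" for d
  proof -
    have "card (multisets_of_size {..<r} d) = (r - 1 + d) choose d"
      using r(1) by (simp add: card_multisets_of_size)
    then show ?thesis
      using card_subset_eq[of "multisets_of_size {..<r} d" "L d"] card_L[of d] L_subset[of d]
      by (auto simp: finite_multisets_of_size)
  qed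
  have ne: "L d \<noteq> {}" if "d \<le> e" for d
    using that
  proof (induction rule: inc_induct)
    case base
    then show ?case using card_L[of e] e(2) by auto
  next
    case (step d)
    then obtain N where N: "N \<in> L (Suc d)" by auto
    then have "size N = Suc d" using L_subset[of "Suc d"] by (auto simp: multisets_of_size_def)
    then obtain x M where "N = add_mset x M" by (cases N) auto
    then have "M \<in> shadow (L (Suc d))" using N by (auto simp: shadow_def)
    then show ?case using shadow_L_subset by blast
  qed
  have lower: "lower_shift (h (Suc d)) (Suc d) = card (shadow (L (Suc d)))" if "Suc d \<le> e" for d
    using lower_shift_initial_segment[OF initial ne[OF that]] card_L[of "Suc d"] by simp
  have gap: "1 \<le> d \<and> d \<le> e \<and> shadow (L (Suc d)) \<noteq> L d" if "s d \<noteq> 0" for d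
  proof -
    have d: "1 \<le> d" "d \<le> e" using that s_0 s_above by (metis less_one linorder_not_le)+
    have "shadow (L (Suc d)) \<noteq> L d"
    proof (cases "d = e")
      case True
      then show ?thesis using L_empty[of "Suc d"] ne[of d] by (simp add: shadow_def)
    next
      case False
      then have "s d = int (card (L d)) - int (card (shadow (L (Suc d))))"
        using s_mid d lower[of d] card_L[of d] by simp
      then show ?thesis using that by auto
    qed
    then show ?thesis using d by simp
  qed
  consider (pure) "s (t + 1) \<noteq> 0" "s (t + 2) \<noteq> 0"
    | (adjacent) i where "s i \<noteq> 0" "s (i + 1) \<noteq> 0"
        "lower_shift (h (i + 1)) (i + 1) < lower_shift (h (i + 1) + 1) (i + 1)"
    | (top) "s (e - 1) \<noteq> 0"
    using cond by auto
  then show ?thesis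
  proof cases
    case pure
    have "L t = multisets_of_size {..<r} t" "L (Suc t) \<noteq> multisets_of_size {..<r} (Suc t)"
      using t full_iff[of t] full_iff[of "Suc t"] by auto
    then obtain Y K where "order_sequence r (L(Suc t := Y, Suc (Suc t) := K))"
      "card Y = card (L (Suc t))" "card K = card (L (Suc (Suc t)))"
      "card (shadow (L (Suc (Suc t)))) < card (shadow K)"
      using exchange_Max_pure_power[of t] gap[OF pure(1)] gap[OF pure(2)] by auto
    then show ?thesis
      using that[of L "L(Suc t := Y, Suc (Suc t) := K)" "Suc t"] order card_L by auto
  next
    case (adjacent i)
    define b where "b = Min (multisets_of_size {..<r} (Suc i) - L (Suc i))"
    have gaps: "shadow (L (Suc i)) \<noteq> L i" "shadow (L (Suc (Suc i))) \<noteq> L (Suc i)" "Suc i \<le> e"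
      using gap[OF adjacent(1)] gap[OF adjacent(2)] by auto
    have "L (Suc i) \<noteq> multisets_of_size {..<r} (Suc i)"
    proof
      assume full: "L (Suc i) = multisets_of_size {..<r} (Suc i)"
      have "L i \<subseteq> shadow (L (Suc i))"
      proof
        fix F assume "F \<in> L i"
        then have "F \<in> multisets_of_size {..<r} i" using L_subset by blast
        from add_zero_mem[OF this] show "F \<in> shadow (L (Suc i))"
          unfolding shadow_L by (simp add: full)
      qed
      then show False using gaps(1) shadow_L_subset by blast
    qed
    note full = this
    note ins = initial_segment_insert_Min[OF finite_lessThan initial full, folded b_def]
    have "card (insert b (L (Suc i))) = h (Suc i) + 1" using ins(3) finite_L card_L by simp
    then have "lower_shift (h (Suc i) + 1) (Suc i) = card (shadow (insert b (L (Suc i))))"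
      using lower_shift_initial_segment[OF ins(1)] by simp
    then have "card (shadow (L (Suc i))) < card (shadow (insert b (L (Suc i))))"
      using adjacent(3) lower[OF gaps(3)] by simp
    then obtain K where "order_sequence r (L(Suc i := K))" "card K = card (L (Suc i))"
      "card (shadow (L (Suc i))) < card (shadow K)"
      using exchange_Max_next[OF full gaps(1,2)] unfolding b_def by blast
    then show ?thesis using that[of L "L(Suc i := K)" i] order card_L by auto
  next
    case top
    obtain i where i: "e = Suc i" using e(1) by (cases e) auto
    obtain K where "order_sequence r (L(Suc i := K))" "card K = card (L (Suc i))"
      "card (shadow (L (Suc i))) < card (shadow K)"
      using exchange_Min_top[of i] gap[OF top] ne[of e] L_empty[of "Suc e"] i by auto
    then show ?thesis using that[of L "L(Suc i := K)" i] order card_L by auto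
  qed
qed

section \<open>Polynomials and quotients by proper ideals\<close>

text \<open>
  Exponent vectors are translated into multisets to have a multiplicative well-order on monomials in which
  the variable with the largest index dominates.
\<close>

definition mset_of_monomial :: "(nat \<Rightarrow>\<^sub>0 nat) \<Rightarrow> nat multiset" where
  "mset_of_monomial m = Abs_multiset (Poly_Mapping.lookup m)"

lemma count_mset_of_monomial [simp]: "count (mset_of_monomial m) x = Poly_Mapping.lookup m x"
proof -
  have "{x. 0 < Poly_Mapping.lookup m x} = {x. Poly_Mapping.lookup m x \<noteq> 0}" by auto
  then show ?thesis by (simp add: mset_of_monomial_def)
qed

lemma mset_of_monomial_add: "mset_of_monomial (a + b) = mset_of_monomial a + mset_of_monomial b"
  by (rule multiset_eqI) (simp add: lookup_add)

lemma mset_of_monomial_var: "mset_of_monomial (Poly_Mapping.single j (Suc 0)) = {#j#}"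
  by (rule multiset_eqI) (simp add: lookup_single when_def)

lemma set_mset_of_monomial: "set_mset (mset_of_monomial m) = Poly_Mapping.keys m"
  by (auto simp: set_mset_def in_keys_iff)

lemma size_mset_of_monomial: "size (mset_of_monomial m) = monomial_degree m"
  by (simp add: size_multiset_overloaded_eq set_mset_of_monomial monomial_degree_def)

lemma inj_mset_of_monomial: "inj mset_of_monomial"
  by (rule injI) (metis poly_mapping_eqI count_mset_of_monomial)

lemma mset_of_monomial_eq_iff: "mset_of_monomial a = mset_of_monomial b \<longleftrightarrow> a = b"
  using inj_mset_of_monomial by (auto dest: injD)

lemma mset_of_monomial_surj: "\<exists>m. mset_of_monomial m = M"
proof (intro exI[of _ "Poly_Mapping.Abs_poly_mapping (count M)"] multiset_eqI)
  fix x
  have "finite {x. count M x \<noteq> 0}" by simp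
  then show "count (mset_of_monomial (Poly_Mapping.Abs_poly_mapping (count M))) x = count M x" by simp
qed

lemma mset_of_monomial_mem_iff:
  "mset_of_monomial m \<in> multisets_of_size {..<r} d \<longleftrightarrow>
     Poly_Mapping.keys m \<subseteq> {..<r} \<and> monomial_degree m = d"
  by (auto simp: multisets_of_size_def set_mset_of_monomial size_mset_of_monomial)

lemma bij_betw_mset_of_monomial:
  "bij_betw mset_of_monomial {m. mset_of_monomial m \<in> X} X"
  unfolding bij_betw_def using mset_of_monomial_surj
  by (auto intro: inj_on_subset[OF inj_mset_of_monomial] simp: image_iff) metis

lemma lookup_monomial_times:
  fixes a :: "nat \<Rightarrow>\<^sub>0 nat" and c :: "'k::field"
  shows "Poly_Mapping.lookup (Poly_Mapping.single a c * p) (a + m) = c * Poly_Mapping.lookup p m"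
  by (simp add: lookup_mult lookup_single when_mult)

lemma keys_monomial_times:
  fixes a :: "nat \<Rightarrow>\<^sub>0 nat" and c :: "'k::field"
  assumes "c \<noteq> 0"
  shows "Poly_Mapping.keys (Poly_Mapping.single a c * p) = (+) a ` Poly_Mapping.keys p"
proof
  show "Poly_Mapping.keys (Poly_Mapping.single a c * p) \<subseteq> (+) a ` Poly_Mapping.keys p"
    using keys_mult[of "Poly_Mapping.single a c" p] assms by auto
  show "(+) a ` Poly_Mapping.keys p \<subseteq> Poly_Mapping.keys (Poly_Mapping.single a c * p)"
    using assms by (auto simp: in_keys_iff lookup_monomial_times)
qed

lemma lookup_const_times:
  "Poly_Mapping.lookup (const_poly c * p) m = c * Poly_Mapping.lookup p m"
  using lookup_monomial_times[of 0 c p m] by (simp add: const_poly_def)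

lemma keys_const_times: "Poly_Mapping.keys (const_poly c * p) \<subseteq> Poly_Mapping.keys p"
  by (auto simp: in_keys_iff lookup_const_times)

lemma const_times_monomial:
  "const_poly c * Poly_Mapping.single m (1 :: 'k::field) = Poly_Mapping.single m c"
  by (simp add: const_poly_def mult_single)

lemma split_monomial:
  fixes p :: "'k::field mpolynomial"
  assumes "Poly_Mapping.keys p \<subseteq> insert m X"
  shows "Poly_Mapping.keys (p - Poly_Mapping.single m (Poly_Mapping.lookup p m)) \<subseteq> X"
  using assms by (auto simp: in_keys_iff lookup_minus lookup_single when_def split: if_splits)

text \<open>
  A property of polynomials that is closed under linear combinations need only be checked on
  monomials.
\<close>

lemma polynomial_induct_keys:
  fixes P :: "'k::field mpolynomial \<Rightarrow> bool"
  assumes "finite X" and zero: "P 0" and mono: "\<And>m. m \<in> X \<Longrightarrow> P (Poly_Mapping.single m 1)"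
    and add: "\<And>p q. P p \<Longrightarrow> P q \<Longrightarrow> P (p + q)" and scale: "\<And>c p. P p \<Longrightarrow> P (const_poly c * p)"
    and p: "Poly_Mapping.keys p \<subseteq> X"
  shows "P p"
  using assms(1) mono p
proof (induction X arbitrary: p rule: finite_induct)
  case empty
  then show ?case using zero by simp
next
  case (insert m X)
  let ?q = "p - Poly_Mapping.single m (Poly_Mapping.lookup p m)"
  have "P ?q" using split_monomial[OF insert.prems(2)] insert.IH insert.prems(1) by simp
  moreover have "P (Poly_Mapping.single m (Poly_Mapping.lookup p m))"
    using scale[OF insert.prems(1)[of m]] by (simp add: const_times_monomial)
  ultimately have "P (?q + Poly_Mapping.single m (Poly_Mapping.lookup p m))" by (rule add)
  then show ?case by simp
qed

lemma poly_ring_simps [simp]: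
  "carrier (poly_ring r) = {p. \<forall>m\<in>Poly_Mapping.keys p. Poly_Mapping.keys m \<subseteq> {..<r}}"
  "p \<otimes>\<^bsub>poly_ring r\<^esub> q = p * q" "p \<oplus>\<^bsub>poly_ring r\<^esub> q = p + q"
  "\<zero>\<^bsub>poly_ring r\<^esub> = 0" "\<one>\<^bsub>poly_ring r\<^esub> = 1"
  by (simp_all add: poly_ring_def)

lemma poly_ring_minus:
  fixes p q :: "'k::field mpolynomial"
  assumes "p \<in> carrier (poly_ring r)"
  shows "\<ominus>\<^bsub>poly_ring r\<^esub> p = - p"
proof -
  interpret cring "poly_ring r :: 'k mpolynomial ring" by (rule poly_ring_cring)
  show ?thesis using assms by (intro minus_equality) auto
qed

lemma poly_ring_diff:
  fixes p q :: "'k::field mpolynomial"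
  assumes "q \<in> carrier (poly_ring r)"
  shows "p \<ominus>\<^bsub>poly_ring r\<^esub> q = p - q"
  using poly_ring_minus[OF assms] by (simp add: a_minus_def)

lemma subfield_const: "subfield (range const_poly :: 'k::field mpolynomial set) (poly_ring r)"
proof -
  interpret cring "poly_ring r :: 'k mpolynomial ring" by (rule poly_ring_cring)
  let ?K = "range const_poly :: 'k mpolynomial set"
  have closed: "?K \<subseteq> carrier (poly_ring r)" by (auto simp: const_poly_def split: if_splits)
  have c_add: "const_poly a + const_poly b = const_poly (a + b)" for a b :: 'k
    by (simp add: const_poly_def single_add)
  have c_mult: "const_poly a * const_poly b = const_poly (a * b)" for a b :: 'k
    by (simp add: const_poly_def mult_single)
  have c_minus: "- const_poly a = const_poly (- a)" for a :: 'k
    by (simp add: const_poly_def single_uminus)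
  have one: "(1 :: 'k mpolynomial) = const_poly 1" and zero: "(0 :: 'k mpolynomial) = const_poly 0"
    by (simp_all add: const_poly_def)
  have inj: "const_poly a = const_poly b \<longleftrightarrow> a = b" for a b :: 'k
    unfolding const_poly_def by (metis lookup_single_eq)
  show ?thesis
  proof (rule subfieldI)
    show "subcring ?K (poly_ring r)"
    proof (rule subcringI', rule subringI)
      fix h assume h: "h \<in> ?K"
      then show "\<ominus>\<^bsub>poly_ring r\<^esub> h \<in> ?K"
        using poly_ring_minus[of h r] closed c_minus by auto
    qed (use closed c_add c_mult one in auto)
    show "Units (poly_ring r\<lparr>carrier := ?K\<rparr>) = ?K - {\<zero>\<^bsub>poly_ring r\<^esub>}"
    proof (intro equalityI subsetI)
      fix u assume "u \<in> Units (poly_ring r\<lparr>carrier := ?K\<rparr>)"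
      then obtain v where "u \<in> ?K" "v * u = 1"
        by (auto simp: Units_def)
      then show "u \<in> ?K - {\<zero>\<^bsub>poly_ring r\<^esub>}" by auto
    next
      fix u assume "u \<in> ?K - {\<zero>\<^bsub>poly_ring r\<^esub>}"
      then obtain a :: 'k where a: "u = const_poly a" "a \<noteq> 0" using zero by auto
      have "u \<in> ?K" "const_poly (inverse a) \<in> ?K" "u * const_poly (inverse a) = 1"
        "const_poly (inverse a) * u = 1"
        using a one by (simp_all add: c_mult)
      then show "u \<in> Units (poly_ring r\<lparr>carrier := ?K\<rparr>)"
        unfolding Units_def by auto
    qed
  qed
qed

locale poly_quotient =
  fixes r :: nat and I :: "'k::field mpolynomial set"
  assumes ideal: "ideal I (poly_ring r)" and proper: "1 \<notin> I"
begin

abbreviation R where "R \<equiv> poly_ring r :: 'k mpolynomial ring"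
abbreviation Q where "Q \<equiv> R Quot I"
abbreviation res where "res \<equiv> residue_class r I"

lemma res_eq: "res = (+>\<^bsub>R\<^esub>) I"
  by (rule ext) (simp add: residue_class_def)

lemma I_add: "p \<in> I \<Longrightarrow> q \<in> I \<Longrightarrow> p + q \<in> I"
  using additive_subgroup.a_closed[OF ideal.axioms(1)[OF ideal]] by simp

lemma I_times: "p \<in> I \<Longrightarrow> q \<in> carrier R \<Longrightarrow> q * p \<in> I"
  using ideal.I_l_closed[OF ideal, of p q] by simp

lemma zero_I: "0 \<in> I"
  using additive_subgroup.zero_closed[OF ideal.axioms(1)[OF ideal]] by simp

lemma const_carrier: "const_poly c \<in> carrier R"
  by (auto simp: const_poly_def split: if_splits)

lemma I_scale: "p \<in> I \<Longrightarrow> const_poly c * p \<in> I"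
  using I_times const_carrier by blast

lemma res_hom: "ring_hom_ring R Q res"
  unfolding res_eq using ideal.rcos_ring_hom_ring[OF ideal] .

lemma cring_Q: "cring Q"
  using ideal.quotient_is_cring[OF ideal poly_ring_cring] .

lemma res_eq_iff:
  assumes "p \<in> carrier R" "q \<in> carrier R"
  shows "res p = res q \<longleftrightarrow> p - q \<in> I"
proof -
  interpret cring R by (rule poly_ring_cring)
  show ?thesis unfolding res_eq
    using quotient_eq_iff_same_a_r_cos[OF ideal assms] poly_ring_diff[OF assms(2), of p] by simp
qed

lemma res_add:
  assumes "p \<in> carrier R" "q \<in> carrier R"
  shows "res p \<oplus>\<^bsub>Q\<^esub> res q = res (p + q)"
  using ring_hom_ring.homh[OF res_hom] ring_hom_add assms by fastforce

lemma res_mult: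
  assumes "p \<in> carrier R" "q \<in> carrier R"
  shows "res p \<otimes>\<^bsub>Q\<^esub> res q = res (p * q)"
  using ring_hom_ring.homh[OF res_hom] ring_hom_mult assms by fastforce

lemma carrier_Q: "carrier Q = res ` carrier R"
  unfolding res_eq FactRing_def A_RCOSETS_def' by auto

lemma res_zero: "res 0 = \<zero>\<^bsub>Q\<^esub>"
proof -
  interpret cring R by (rule poly_ring_cring)
  show ?thesis unfolding res_eq using a_rcos_zero[OF ideal zero_I] by (simp add: FactRing_def)
qed

lemma res_one: "res 1 = \<one>\<^bsub>Q\<^esub>"
  using ring_hom_one[OF ring_hom_ring.homh[OF res_hom]] by simp

lemma res_zero_iff:
  assumes "p \<in> carrier R"
  shows "res p = \<zero>\<^bsub>Q\<^esub> \<longleftrightarrow> p \<in> I"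
  using res_eq_iff[OF assms, of 0] res_zero by simp

lemma subfield_scalars: "subfield (scalars r I) Q"
proof -
  have "1 \<in> carrier R" by simp
  then have "\<one>\<^bsub>Q\<^esub> \<noteq> \<zero>\<^bsub>Q\<^esub>"
    using res_zero_iff[of 1] proper res_one by simp
  then show ?thesis unfolding scalars_def
    by (rule ring_hom_ring.img_is_subfield(2)[OF res_hom subfield_const])
qed

text \<open>
  The residue classes of the monomials in \<open>X\<close> are a basis of their span when no nonzero element of \<open>I\<close> is
  supported on \<open>X\<close>. All dimensions below are computed in this way.
\<close>

lemma dim_residues:
  assumes "finite X" and vars: "\<And>m. m \<in> X \<Longrightarrow> Poly_Mapping.keys m \<subseteq> {..<r}"
    and indep: "\<And>p. p \<in> I \<Longrightarrow> Poly_Mapping.keys p \<subseteq> X \<Longrightarrow> p = 0"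
  shows "ring.dim Q (scalars r I) (res ` {p. Poly_Mapping.keys p \<subseteq> X}) = card X"
proof -
  interpret cring Q by (rule cring_Q)
  have carrier: "p \<in> carrier R" if "Poly_Mapping.keys p \<subseteq> X" for p using that vars by auto
  have "dimension (card Y) (scalars r I) (res ` {p. Poly_Mapping.keys p \<subseteq> Y})" if "Y \<subseteq> X" for Y
    using finite_subset[OF that assms(1)] that
  proof (induction Y rule: finite_induct)
    case empty
    have "{p :: 'k mpolynomial. Poly_Mapping.keys p \<subseteq> {}} = {0}" by auto
    then show ?case using res_zero by simp
  next
    case (insert m Y)
    let ?E = "res ` {p. Poly_Mapping.keys p \<subseteq> Y}"
    let ?m = "Poly_Mapping.single m (1 :: 'k)"
    have m: "Poly_Mapping.keys ?m \<subseteq> X" using insert.prems by auto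
    have carr: "c \<in> carrier R" if "Poly_Mapping.keys c \<subseteq> Y" for c
      using carrier that insert.prems by blast
    have not_in: "res ?m \<notin> ?E"
    proof
      assume "res ?m \<in> ?E"
      then obtain q where q: "Poly_Mapping.keys q \<subseteq> Y" "res ?m = res q" by auto
      then have "?m - q \<in> I" using res_eq_iff[OF carrier[OF m] carr[OF q(1)]] by simp
      moreover have "Poly_Mapping.keys (?m - q) \<subseteq> X"
        using keys_diff[of ?m q] m q(1) insert.prems by blast
      ultimately have "?m = q" using indep by fastforce
      then show False using q(1) insert.hyps(2) by auto
    qed
    have "line_extension (scalars r I) (res ?m) ?E = res ` {p. Poly_Mapping.keys p \<subseteq> insert m Y}"
    proof (intro equalityI subsetI)
      fix u assume "u \<in> line_extension (scalars r I) (res ?m) ?E"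
      then obtain c q where q: "Poly_Mapping.keys q \<subseteq> Y"
        "u = res (const_poly c) \<otimes>\<^bsub>Q\<^esub> res ?m \<oplus>\<^bsub>Q\<^esub> res q"
        by (auto simp: line_extension_mem_iff scalars_def)
      have c: "Poly_Mapping.single m c \<in> carrier R" using m insert.prems vars by auto
      have "u = res (Poly_Mapping.single m c + q)"
        using q(2) res_mult[OF const_carrier carrier[OF m], of c] res_add[OF c carr[OF q(1)]]
        by (simp add: const_times_monomial)
      moreover have "Poly_Mapping.keys (Poly_Mapping.single m c + q) \<subseteq> insert m Y"
        using keys_add[of "Poly_Mapping.single m c" q] q(1) by (auto split: if_splits)
      ultimately show "u \<in> res ` {p. Poly_Mapping.keys p \<subseteq> insert m Y}" by auto
    next
      fix u assume "u \<in> res ` {p. Poly_Mapping.keys p \<subseteq> insert m Y}"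
      then obtain p where p: "Poly_Mapping.keys p \<subseteq> insert m Y" "u = res p" by auto
      define c where "c = Poly_Mapping.lookup p m"
      define q where "q = p - Poly_Mapping.single m c"
      have q: "Poly_Mapping.keys q \<subseteq> Y" unfolding q_def c_def using split_monomial[OF p(1)] .
      have c: "Poly_Mapping.single m c \<in> carrier R" using m insert.prems vars by auto
      have "u = res (const_poly c) \<otimes>\<^bsub>Q\<^esub> res ?m \<oplus>\<^bsub>Q\<^esub> res q"
        using p(2) res_mult[OF const_carrier carrier[OF m], of c] res_add[OF c carr[OF q]]
        by (simp add: const_times_monomial q_def)
      then show "u \<in> line_extension (scalars r I) (res ?m) ?E"
        using q by (auto simp: line_extension_mem_iff scalars_def)
    qed
    moreover have "res ?m \<in> carrier Q" using carrier[OF m] by (auto simp only: carrier_Q)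
    ultimately show ?case
      using Suc_dim[OF _ not_in] insert by (metis card_insert_disjoint insert_subset)
  qed
  from this[of X] show ?thesis
    using dimI[OF subfield_scalars] unfolding over_def by simp
qed

end

section \<open>Standard monomials of an ideal\<close>

lemma forms_iff:
  "p \<in> forms r d \<longleftrightarrow> (\<forall>m\<in>Poly_Mapping.keys p. mset_of_monomial m \<in> multisets_of_size {..<r} d)"
  by (auto simp: forms_def mset_of_monomial_mem_iff)

text \<open>
  The monomials of degree \<open>d\<close> that are not the leading monomial of a form in \<open>I\<close>.
\<close>

definition standard_monomials :: "nat \<Rightarrow> 'k::field mpolynomial set \<Rightarrow> nat \<Rightarrow> nat multiset set" where
  "standard_monomials r I d = {M \<in> multisets_of_size {..<r} d.
     \<not> (\<exists>p\<in>I \<inter> forms r d. \<exists>m\<in>Poly_Mapping.keys p. mset_of_monomial m = M \<and>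
          (\<forall>m'\<in>Poly_Mapping.keys p. mset_of_monomial m' \<le> M))}"

lemma var_poly_carrier: "j < r \<Longrightarrow> var_poly j \<in> carrier (poly_ring r)"
  by (auto simp: var_poly_def split: if_splits)

lemma finite_monomials:
  assumes "X \<subseteq> multisets_of_size {..<r} d"
  shows "finite {m. mset_of_monomial m \<in> X}"
  using bij_betw_finite[OF bij_betw_mset_of_monomial[of X]] assms
    finite_subset_multisets_of_size[of "{..<r}" X d] by simp

context poly_quotient
begin

text \<open>
  Multiplying a form by a variable multiplies its leading monomial by that variable.
\<close>

lemma order_sequence_standard_monomials: "order_sequence r (standard_monomials r I)"
  unfolding order_sequence_def
proof (intro allI conjI subsetI)
  fix d M
  show "M \<in> standard_monomials r I d \<Longrightarrow> M \<in> multisets_of_size {..<r} d"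
    by (simp add: standard_monomials_def)
  assume "M \<in> shadow (standard_monomials r I (Suc d))"
  then obtain x where x: "add_mset x M \<in> standard_monomials r I (Suc d)" by (auto simp: shadow_def)
  then have "add_mset x M \<in> multisets_of_size {..<r} (Suc d)" by (simp add: standard_monomials_def)
  then have "x < r" and M: "M \<in> multisets_of_size {..<r} d" by (auto simp: multisets_of_size_def)
  show "M \<in> standard_monomials r I d"
  proof (rule ccontr)
    assume "M \<notin> standard_monomials r I d"
    then obtain p m where p: "p \<in> I" "p \<in> forms r d" "m \<in> Poly_Mapping.keys p" "mset_of_monomial m = M"
      "\<And>m'. m' \<in> Poly_Mapping.keys p \<Longrightarrow> mset_of_monomial m' \<le> M"
      using M unfolding standard_monomials_def by blast
    define e where "e = Poly_Mapping.single x (1 :: nat)"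
    define q where "q = var_poly x * p"
    have e: "mset_of_monomial e = {#x#}" by (simp add: e_def mset_of_monomial_var)
    have "q \<in> I" unfolding q_def using I_times[OF p(1) var_poly_carrier[OF \<open>x < r\<close>]] .
    moreover have keys_q: "Poly_Mapping.keys q = (+) e ` Poly_Mapping.keys p"
      unfolding q_def var_poly_def e_def by (rule keys_monomial_times) simp
    moreover have "q \<in> forms r (Suc d)"
      using p(2) \<open>x < r\<close> unfolding forms_iff keys_q
      by (auto simp: mset_of_monomial_add e multisets_of_size_def)
    moreover have "mset_of_monomial (e + m) = add_mset x M"
      using p(4) by (simp add: mset_of_monomial_add e)
    moreover have "\<forall>m'\<in>Poly_Mapping.keys q. mset_of_monomial m' \<le> add_mset x M"
      using p(5) unfolding keys_q by (auto simp: mset_of_monomial_add e)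
    ultimately show False using x p(3) unfolding standard_monomials_def by blast
  qed
qed

definition reducible :: "nat \<Rightarrow> 'k mpolynomial \<Rightarrow> bool" where
  "reducible d p \<longleftrightarrow> (\<exists>q. (\<forall>n\<in>Poly_Mapping.keys q. mset_of_monomial n \<in> standard_monomials r I d)
     \<and> p - q \<in> I)"

lemma reducible_by_monomials:
  assumes "\<And>m. m \<in> Poly_Mapping.keys p \<Longrightarrow> reducible d (Poly_Mapping.single m 1)"
  shows "reducible d p"
proof (rule polynomial_induct_keys[of "Poly_Mapping.keys p"])
  show "reducible d 0" using zero_I by (auto simp: reducible_def intro!: exI[of _ 0])
next
  fix f g assume "reducible d f" "reducible d g"
  then obtain f' g' where
    fg: "\<forall>n\<in>Poly_Mapping.keys f'. mset_of_monomial n \<in> standard_monomials r I d" "f - f' \<in> I"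
      "\<forall>n\<in>Poly_Mapping.keys g'. mset_of_monomial n \<in> standard_monomials r I d" "g - g' \<in> I"
    by (auto simp: reducible_def)
  have "(f + g) - (f' + g') \<in> I" using I_add[OF fg(2,4)] by (simp add: algebra_simps)
  then show "reducible d (f + g)" using fg(1,3) keys_add[of f' g'] unfolding reducible_def by blast
next
  fix a f assume "reducible d f"
  then obtain f' where
    f: "\<forall>n\<in>Poly_Mapping.keys f'. mset_of_monomial n \<in> standard_monomials r I d" "f - f' \<in> I"
    by (auto simp: reducible_def)
  have "const_poly a * f - const_poly a * f' \<in> I"
    using I_scale[OF f(2), of a] by (simp add: algebra_simps)
  then show "reducible d (const_poly a * f)"
    using f(1) keys_const_times[of a f'] unfolding reducible_def by blast
qed (use assms in auto)

text \<open>
  The division algorithm: a leading monomial of an element of \<open>I\<close> is congruent to a combination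
  of smaller monomials.
\<close>

lemma reducible_monomial:
  assumes "mset_of_monomial m \<in> multisets_of_size {..<r} d"
  shows "reducible d (Poly_Mapping.single m 1)"
  using assms
proof (induction "mset_of_monomial m" arbitrary: m rule: less_induct)
  case less
  show ?case
  proof (cases "mset_of_monomial m \<in> standard_monomials r I d")
    case True
    then show ?thesis using zero_I
      unfolding reducible_def by (intro exI[of _ "Poly_Mapping.single m 1"]) auto
  next
    case False
    then obtain p where p: "p \<in> I" "p \<in> forms r d" "m \<in> Poly_Mapping.keys p"
      "\<And>m'. m' \<in> Poly_Mapping.keys p \<Longrightarrow> mset_of_monomial m' \<le> mset_of_monomial m"
      using less.prems unfolding standard_monomials_def by (auto simp: mset_of_monomial_eq_iff)
    define c where "c = Poly_Mapping.lookup p m"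
    have c: "c \<noteq> 0" using p(3) by (simp add: c_def in_keys_iff)
    define p' where "p' = Poly_Mapping.single m 1 - const_poly (inverse c) * p"
    have lookup_p': "Poly_Mapping.lookup p' n =
        (if n = m then 0 else - inverse c * Poly_Mapping.lookup p n)" for n
      using c by (simp add: p'_def lookup_minus lookup_const_times lookup_single when_def c_def)
    have "reducible d p'"
    proof (rule reducible_by_monomials)
      fix n assume "n \<in> Poly_Mapping.keys p'"
      then have n: "n \<in> Poly_Mapping.keys p" "n \<noteq> m"
        by (auto simp: in_keys_iff lookup_p' split: if_splits)
      then have "mset_of_monomial n < mset_of_monomial m"
        using p(4)[of n] by (simp add: order_less_le mset_of_monomial_eq_iff)
      moreover have "mset_of_monomial n \<in> multisets_of_size {..<r} d"
        using n p(2) by (simp add: forms_iff)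
      ultimately show "reducible d (Poly_Mapping.single n 1)" by (rule less.hyps)
    qed
    then obtain q where
      q: "\<forall>n\<in>Poly_Mapping.keys q. mset_of_monomial n \<in> standard_monomials r I d" "p' - q \<in> I"
      by (auto simp: reducible_def)
    have "Poly_Mapping.single m 1 - q = (p' - q) + const_poly (inverse c) * p" by (simp add: p'_def)
    also have "\<dots> \<in> I" using I_add[OF q(2) I_scale[OF p(1)]] .
    finally show ?thesis using q(1) unfolding reducible_def by blast
  qed
qed

text \<open>
  Standard monomials span a graded piece by reduction, and they are independent modulo \<open>I\<close> because the
  leading monomial of a nonzero form in \<open>I\<close> is not standard.
\<close>

lemma h_vector_standard_monomials: "h_vector r I d = card (standard_monomials r I d)"
proof -
  define X where "X = {m. mset_of_monomial m \<in> standard_monomials r I d}"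
  have sub: "standard_monomials r I d \<subseteq> multisets_of_size {..<r} d" by (auto simp: standard_monomials_def)
  have forms: "p \<in> forms r d" if "Poly_Mapping.keys p \<subseteq> X" for p :: "'k mpolynomial"
    using that sub by (auto simp: forms_iff X_def)
  have "graded_piece r I d = res ` {p. Poly_Mapping.keys p \<subseteq> X}"
  proof
    show "graded_piece r I d \<subseteq> res ` {p. Poly_Mapping.keys p \<subseteq> X}"
    proof
      fix u assume "u \<in> graded_piece r I d"
      then obtain p where p: "p \<in> forms r d" "u = res p" by (auto simp: graded_piece_def)
      obtain q where q: "Poly_Mapping.keys q \<subseteq> X" "p - q \<in> I"
        using reducible_by_monomials[of p d] reducible_monomial p(1)
        unfolding reducible_def X_def forms_iff by blast
      have "p \<in> carrier R" "q \<in> carrier R" using p(1) forms[OF q(1)] by (simp_all add: forms_def)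
      then have "u = res q" using p(2) q(2) res_eq_iff by simp
      then show "u \<in> res ` {p. Poly_Mapping.keys p \<subseteq> X}" using q(1) by blast
    qed
    show "res ` {p. Poly_Mapping.keys p \<subseteq> X} \<subseteq> graded_piece r I d"
      using forms by (auto simp: graded_piece_def)
  qed
  moreover have "ring.dim Q (scalars r I) (res ` {p. Poly_Mapping.keys p \<subseteq> X}) = card X"
  proof (rule dim_residues)
    show "finite X" unfolding X_def by (rule finite_monomials[OF sub])
    show "Poly_Mapping.keys m \<subseteq> {..<r}" if "m \<in> X" for m
      using that sub mset_of_monomial_mem_iff unfolding X_def by blast
    fix p assume p: "p \<in> I" "Poly_Mapping.keys p \<subseteq> X"
    show "p = 0"
    proof (rule ccontr)
      assume "p \<noteq> 0"
      let ?S = "mset_of_monomial ` Poly_Mapping.keys p"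
      have "?S \<noteq> {}" using \<open>p \<noteq> 0\<close> by simp
      then have "Max ?S \<in> ?S" by (intro Max_in) auto
      then obtain m where m: "m \<in> Poly_Mapping.keys p" "mset_of_monomial m = Max ?S" by force
      then have "mset_of_monomial m \<in> standard_monomials r I d" using p(2) by (auto simp: X_def)
      then show False
        using p(1) forms[OF p(2)] m unfolding standard_monomials_def by auto
    qed
  qed
  moreover have "card X = card (standard_monomials r I d)"
    unfolding X_def by (rule bij_betw_same_card[OF bij_betw_mset_of_monomial])
  ultimately show ?thesis by (simp add: h_vector_def)
qed

end

lemma standard_graded_artinian_poly_quotient:
  fixes I :: "'k::field mpolynomial set"
  assumes "standard_graded_artinian r I"
  shows "poly_quotient r I"
proof (rule poly_quotient.intro)
  show ideal: "ideal I (poly_ring r)"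
    using assms by (simp add: standard_graded_artinian_def homogeneous_ideal_def)
  show "1 \<notin> I"
  proof
    assume "1 \<in> I"
    have r: "0 < r" and linear: "I \<inter> forms r 1 \<subseteq> {0}"
      using assms by (simp_all add: standard_graded_artinian_def)
    have "var_poly 0 * 1 \<in> I"
      using ideal.I_l_closed[OF ideal \<open>1 \<in> I\<close> var_poly_carrier[OF r]] by simp
    moreover have "(var_poly 0 :: 'k mpolynomial) \<in> forms r 1"
      using r by (simp add: forms_iff var_poly_def mset_of_monomial_var multisets_of_size_def)
    ultimately have "(var_poly 0 :: 'k mpolynomial) = 0" using linear by auto
    then show False unfolding var_poly_def by (metis lookup_single_eq lookup_zero zero_neq_one)
  qed
qed

lemma h_vector_order_sequence:
  fixes I :: "'k::field mpolynomial set"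
  assumes "standard_graded_artinian r I"
  shows "\<exists>B. order_sequence r B \<and> (\<forall>d. card (B d) = h_vector r I d)" "h_vector r I 1 = r" "0 < r"
proof -
  interpret poly_quotient r I by (rule standard_graded_artinian_poly_quotient[OF assms])
  show "\<exists>B. order_sequence r B \<and> (\<forall>d. card (B d) = h_vector r I d)"
    using order_sequence_standard_monomials h_vector_standard_monomials by metis
  show "0 < r" using assms by (simp add: standard_graded_artinian_def)
  have "standard_monomials r I 1 = multisets_of_size {..<r} 1"
    using assms unfolding standard_graded_artinian_def standard_monomials_def by fastforce
  then show "h_vector r I 1 = r"
    using h_vector_standard_monomials[of 1] by (simp add: card_multisets_of_size)
qed

section \<open>Monomial algebras\<close>

definition monomial_ideal :: "nat \<Rightarrow> (nat \<Rightarrow> nat multiset set) \<Rightarrow> 'k::field mpolynomial set" where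
  "monomial_ideal r M = {p \<in> carrier (poly_ring r).
     \<forall>m\<in>Poly_Mapping.keys p. mset_of_monomial m \<notin> M (monomial_degree m)}"

lemma order_sequence_divisor:
  assumes "order_sequence r M" "A + B \<in> M (size A + size B)"
  shows "B \<in> M (size B)"
  using assms(2)
proof (induction A)
  case (add x A)
  then have "add_mset x (A + B) \<in> M (Suc (size A + size B))" by simp
  then have "A + B \<in> shadow (M (Suc (size A + size B)))" by (auto simp: shadow_def)
  then show ?case using add.IH assms(1) by (auto simp: order_sequence_def)
qed simp

lemma ideal_monomial_ideal:
  assumes "order_sequence r M"
  shows "ideal (monomial_ideal r M :: 'k::field mpolynomial set) (poly_ring r)"
proof -
  interpret cring "poly_ring r :: 'k mpolynomial ring" by (rule poly_ring_cring)
  let ?I = "monomial_ideal r M :: 'k mpolynomial set"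
  have times: "q * p \<in> ?I" if p: "p \<in> ?I" and q: "q \<in> carrier (poly_ring r)" for p q
  proof -
    have "mset_of_monomial m \<notin> M (monomial_degree m)" if m: "m \<in> Poly_Mapping.keys (q * p)" for m
    proof
      obtain a b where ab: "m = a + b" "b \<in> Poly_Mapping.keys p"
        using m keys_mult[of q p] by blast
      assume "mset_of_monomial m \<in> M (monomial_degree m)"
      then have "mset_of_monomial a + mset_of_monomial b \<in> M (size (mset_of_monomial a) + size (mset_of_monomial b))"
        by (simp add: ab(1) mset_of_monomial_add flip: size_mset_of_monomial)
      from order_sequence_divisor[OF assms this] have "mset_of_monomial b \<in> M (monomial_degree b)"
        by (simp add: size_mset_of_monomial)
      then show False using p ab(2) by (simp add: monomial_ideal_def)
    qed
    moreover have "q * p \<in> carrier (poly_ring r)"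
      using m_closed[of q p] p q by (simp add: monomial_ideal_def)
    ultimately show ?thesis by (simp add: monomial_ideal_def)
  qed
  show ?thesis
  proof (rule idealI)
    show "subgroup ?I (add_monoid (poly_ring r))"
    proof (rule add.subgroupI)
      show "?I \<subseteq> carrier (poly_ring r)" by (auto simp: monomial_ideal_def)
      have "0 \<in> ?I" by (simp add: monomial_ideal_def)
      then show "?I \<noteq> {}" by blast
      fix a b assume a: "a \<in> ?I"
      then have "a \<in> carrier (poly_ring r)" by (simp add: monomial_ideal_def)
      then show "\<ominus>\<^bsub>poly_ring r\<^esub> a \<in> ?I"
        using a poly_ring_minus[of a r] by (simp add: monomial_ideal_def)
      assume b: "b \<in> ?I"
      show "a \<oplus>\<^bsub>poly_ring r\<^esub> b \<in> ?I"
        using a b keys_add[of a b] by (fastforce simp: monomial_ideal_def)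
    qed
  next
    fix a x :: "'k mpolynomial" assume a: "a \<in> ?I" "x \<in> carrier (poly_ring r)"
    show "x \<otimes>\<^bsub>poly_ring r\<^esub> a \<in> ?I" using times[OF a] by simp
    show "a \<otimes>\<^bsub>poly_ring r\<^esub> x \<in> ?I" using times[OF a] by (simp add: mult.commute)
  qed (rule ring_axioms)
qed

text \<open>
  Finite-dimensional spaces satisfy the descending chain condition. Induction on the set of
  coordinates: the subspaces \<open>W n\<close> with vanishing coordinate \<open>m\<close> become stationary, and so does the
  condition that \<open>V n = W n\<close>. If \<open>V n\<close> contains some \<open>q\<close> with nonzero coordinate, any member of \<open>V N\<close> is the sum
  of a multiple of \<open>q\<close> and an element of \<open>W N\<close>.
\<close>

lemma subspace_chain_stabilizes:
  fixes V :: "nat \<Rightarrow> 'k::field mpolynomial set"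
  assumes "finite B" and sub: "\<And>n p. p \<in> V n \<Longrightarrow> Poly_Mapping.keys p \<subseteq> B"
    and dec: "\<And>n. V (Suc n) \<subseteq> V n"
    and diff: "\<And>n p q. p \<in> V n \<Longrightarrow> q \<in> V n \<Longrightarrow> p - q \<in> V n"
    and scale: "\<And>n c p. p \<in> V n \<Longrightarrow> const_poly c * p \<in> V n"
    and zero: "\<And>n. 0 \<in> V n"
  shows "\<exists>N. \<forall>n\<ge>N. V n = V N"
  using assms
proof (induction B arbitrary: V rule: finite_induct)
  case empty
  then have "V n = {0}" for n by auto
  then show ?case by simp
next
  case (insert m B)
  define W where "W n = {p \<in> V n. Poly_Mapping.lookup p m = 0}" for n
  have anti: "V n \<subseteq> V N" if "N \<le> n" for n N
    using lift_Suc_antimono_le[of V, OF insert.prems(2) that] .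
  have "\<exists>N. \<forall>n\<ge>N. W n = W N"
  proof (rule insert.IH)
    show "Poly_Mapping.keys p \<subseteq> B" if "p \<in> W n" for n p
      using that insert.prems(1)[of p n] by (auto simp: W_def in_keys_iff)
    show "W (Suc n) \<subseteq> W n" for n using insert.prems(2)[of n] by (auto simp: W_def)
  qed (use insert.prems in \<open>auto simp: W_def lookup_minus lookup_const_times\<close>)
  then obtain N1 where N1: "\<And>n. n \<ge> N1 \<Longrightarrow> W n = W N1" by blast
  \<comment> \<open>Once all elements of some \<open>V N\<close> have coordinate \<open>0\<close>, this remains so; otherwise it never happens and \<open>N2 = 0\<close> serves.\<close>
  obtain N2 where N2: "\<And>n. n \<ge> N2 \<Longrightarrow> V n = W n \<longleftrightarrow> V N2 = W N2"
  proof (cases "\<exists>N. V N = W N")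
    case True
    then obtain N where N: "V N = W N" by blast
    have "V n = W n" if "n \<ge> N" for n using N anti[OF that] by (auto simp: W_def)
    then show ?thesis using that[of N] by blast
  qed (use that[of 0] in blast)
  define N where "N = max N1 N2"
  have "V n = V N" if n: "n \<ge> N" for n
  proof
    show "V n \<subseteq> V N" using anti[OF n] .
    have W: "W n = W N" using N1[of n] N1[of N] n by (simp add: N_def)
    show "V N \<subseteq> V n"
    proof
      fix p assume p: "p \<in> V N"
      show "p \<in> V n"
      proof (cases "V n = W n")
        case True
        then have "V N = W N" using N2[of n] N2[of N] n by (simp add: N_def)
        then show ?thesis using True W p by simp
      next
        case False
        then obtain q where q: "q \<in> V n" "Poly_Mapping.lookup q m \<noteq> 0" by (auto simp: W_def)
        define c where "c = Poly_Mapping.lookup p m / Poly_Mapping.lookup q m"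
        have cq: "const_poly c * q \<in> V n" using insert.prems(4)[OF q(1)] .
        then have "p - const_poly c * q \<in> V N" using insert.prems(3)[OF p] anti[OF n] by blast
        then have "p - const_poly c * q \<in> W N"
          using q(2) by (simp add: W_def lookup_minus lookup_const_times c_def)
        then have "p - const_poly c * q \<in> V n" using W by (auto simp: W_def)
        \<comment> \<open>Sums are differences with a multiple by \<open>- 1\<close>.\<close>
        then have "(p - const_poly c * q) - const_poly (- 1) * (const_poly c * q) \<in> V n"
          using insert.prems(3) insert.prems(4)[OF cq] by blast
        then show ?thesis by (simp add: const_poly_def single_uminus)
      qed
    qed
  qed
  then show ?case by blast
qed

lemma keys_homogeneous_component:
  "Poly_Mapping.keys (homogeneous_component d p) \<subseteq> Poly_Mapping.keys p"
proof
  fix n assume "n \<in> Poly_Mapping.keys (homogeneous_component d p)"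
  then have "(\<Sum>m\<in>{m \<in> Poly_Mapping.keys p. monomial_degree m = d}.
      Poly_Mapping.lookup (Poly_Mapping.single m (Poly_Mapping.lookup p m)) n) \<noteq> 0"
    by (simp add: homogeneous_component_def in_keys_iff lookup_sum)
  then obtain m where "m \<in> Poly_Mapping.keys p"
      "Poly_Mapping.lookup (Poly_Mapping.single m (Poly_Mapping.lookup p m)) n \<noteq> 0"
    by (metis (no_types, lifting) mem_Collect_eq sum.neutral)
  then show "n \<in> Poly_Mapping.keys p" by (auto simp: lookup_single when_def split: if_splits)
qed

locale monomial_quotient =
  fixes r :: nat and M :: "nat \<Rightarrow> nat multiset set" and I :: "'k::field mpolynomial set" and e :: nat
  assumes r_pos: "0 < r" and order: "order_sequence r M" and linear: "M 1 = multisets_of_size {..<r} 1"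
    and bounded: "\<And>d. e < d \<Longrightarrow> M d = {}" and I_def: "I = monomial_ideal r M"
begin

lemma M_subset: "M d \<subseteq> multisets_of_size {..<r} d"
  using order by (simp add: order_sequence_def)

lemma empty_mem: "{#} \<in> M 0"
proof -
  have "{#0#} \<in> M 1" using r_pos unfolding linear by (simp add: multisets_of_size_def)
  then have "{#} \<in> shadow (M (Suc 0))" by (auto simp: shadow_def)
  then show ?thesis using order by (auto simp: order_sequence_def)
qed

lemma mem_I_iff: "p \<in> I \<longleftrightarrow> p \<in> carrier (poly_ring r) \<and>
    (\<forall>m\<in>Poly_Mapping.keys p. mset_of_monomial m \<notin> M (monomial_degree m))"
  by (simp add: I_def monomial_ideal_def)

sublocale poly_quotient r I
proof (rule poly_quotient.intro)
  show "ideal I (poly_ring r)" unfolding I_def using ideal_monomial_ideal[OF order] .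
  have "mset_of_monomial 0 = {#}" by (rule multiset_eqI) simp
  then show "1 \<notin> I" using empty_mem by (simp add: mem_I_iff monomial_degree_def)
qed

definition basis :: "(nat \<Rightarrow>\<^sub>0 nat) set" where
  "basis = {m. mset_of_monomial m \<in> M (monomial_degree m)}"

lemma basis_degree: "m \<in> basis \<and> monomial_degree m = d \<longleftrightarrow> mset_of_monomial m \<in> M d"
proof
  assume "mset_of_monomial m \<in> M d"
  then have "mset_of_monomial m \<in> multisets_of_size {..<r} d" using M_subset by blast
  then have "monomial_degree m = d" by (simp add: mset_of_monomial_mem_iff)
  then show "m \<in> basis \<and> monomial_degree m = d" using \<open>mset_of_monomial m \<in> M d\<close> by (simp add: basis_def)
qed (auto simp: basis_def)

lemma basis_vars: "m \<in> basis \<Longrightarrow> Poly_Mapping.keys m \<subseteq> {..<r}"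
  using M_subset mset_of_monomial_mem_iff unfolding basis_def by blast

lemma finite_basis: "finite basis"
proof -
  have "basis \<subseteq> (\<Union>d\<le>e. {m. mset_of_monomial m \<in> M d})"
  proof
    fix m assume "m \<in> basis"
    then have m: "mset_of_monomial m \<in> M (monomial_degree m)" by (simp add: basis_def)
    then have "monomial_degree m \<le> e" using bounded[of "monomial_degree m"] by fastforce
    then show "m \<in> (\<Union>d\<le>e. {m. mset_of_monomial m \<in> M d})" using m by blast
  qed
  moreover have "finite (\<Union>d\<le>e. {m. mset_of_monomial m \<in> M d})"
    using finite_monomials[OF M_subset] by auto
  ultimately show ?thesis using finite_subset by blast
qed

lemma I_basis_zero:
  assumes "p \<in> I" "Poly_Mapping.keys p \<subseteq> basis"
  shows "p = 0"
proof (rule ccontr)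
  assume "p \<noteq> 0"
  then obtain m where "m \<in> Poly_Mapping.keys p" by fastforce
  then show False using assms by (auto simp: mem_I_iff basis_def)
qed

definition basis_part :: "'k mpolynomial \<Rightarrow> 'k mpolynomial" where
  "basis_part p = (\<Sum>m\<in>Poly_Mapping.keys p \<inter> basis. Poly_Mapping.single m (Poly_Mapping.lookup p m))"

lemma lookup_basis_part:
  "Poly_Mapping.lookup (basis_part p) n = (if n \<in> basis then Poly_Mapping.lookup p n else 0)"
proof -
  have "Poly_Mapping.lookup (basis_part p) n =
      (\<Sum>m\<in>Poly_Mapping.keys p \<inter> basis. if m = n then Poly_Mapping.lookup p m else 0)"
    by (simp add: basis_part_def lookup_sum lookup_single when_def)
  also have "\<dots> = (if n \<in> basis then Poly_Mapping.lookup p n else 0)"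
    by (simp add: in_keys_iff)
  finally show ?thesis .
qed

lemma keys_basis_part: "Poly_Mapping.keys (basis_part p) = Poly_Mapping.keys p \<inter> basis"
  by (auto simp: in_keys_iff lookup_basis_part split: if_splits)

lemma basis_part_carrier: "basis_part p \<in> carrier R"
  using keys_basis_part basis_vars by auto

lemma res_basis_part:
  assumes "p \<in> carrier R"
  shows "res (basis_part p) = res p"
proof -
  have "p - basis_part p \<in> I"
  proof -
    have "m \<in> Poly_Mapping.keys p" "m \<notin> basis" if "m \<in> Poly_Mapping.keys (p - basis_part p)" for m
      using that by (auto simp: in_keys_iff lookup_minus lookup_basis_part split: if_splits)
    then show ?thesis using assms unfolding mem_I_iff basis_def by fastforce
  qed
  then show ?thesis using res_eq_iff[OF assms basis_part_carrier, of p] by simp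
qed

lemma ring_Q: "ring Q"
  using cring_Q by (simp add: cring_def)

text \<open>
  An ideal of the quotient is determined by the combinations of basis monomials
  representing its elements, and these form a subspace of a finite-dimensional space.
\<close>

lemma artinian_Q: "artinian_ring Q"
  unfolding artinian_ring_def
proof (intro conjI allI impI)
  show "ring Q" by (rule ring_Q)
  fix J :: "nat \<Rightarrow> 'k mpolynomial set set"
  assume J: "(\<forall>n. ideal (J n) Q) \<and> (\<forall>n. J (Suc n) \<subseteq> J n)"
  define V where "V n = {p. Poly_Mapping.keys p \<subseteq> basis \<and> res p \<in> J n}" for n
  have carrier: "p \<in> carrier R" if "p \<in> V n" for p n
    using that basis_vars by (auto simp: V_def)
  have scale: "const_poly c * p \<in> V n" if p: "p \<in> V n" for c p n
  proof -
    have "res (const_poly c) \<in> carrier Q" using const_carrier[of c] unfolding carrier_Q by (rule imageI)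
    then have "res (const_poly c) \<otimes>\<^bsub>Q\<^esub> res p \<in> J n"
      using J p ideal.I_l_closed[of "J n" Q] by (auto simp: V_def)
    then have "res (const_poly c * p) \<in> J n" using res_mult[OF const_carrier carrier[OF p]] by simp
    then show ?thesis using p keys_const_times[of c p] by (auto simp: V_def)
  qed
  have "\<exists>N. \<forall>n\<ge>N. V n = V N"
  proof (rule subspace_chain_stabilizes[OF finite_basis])
    show "V (Suc n) \<subseteq> V n" for n using J by (auto simp: V_def)
    show "0 \<in> V n" for n
      using J res_zero additive_subgroup.zero_closed[OF ideal.axioms(1), of "J n" Q] by (auto simp: V_def)
    show "p - q \<in> V n" if p: "p \<in> V n" and q: "q \<in> V n" for n p q
    proof -
      let ?q = "const_poly (- 1) * q"
      have q': "?q \<in> V n" using scale[OF q] .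
      have "res p \<oplus>\<^bsub>Q\<^esub> res ?q \<in> J n"
        using J p q' additive_subgroup.a_closed[OF ideal.axioms(1), of "J n" Q] by (auto simp: V_def)
      then have "res (p + ?q) \<in> J n" using res_add[OF carrier[OF p] carrier[OF q']] by simp
      moreover have "p + ?q = p - q" by (simp add: const_poly_def single_uminus)
      ultimately show ?thesis using p q keys_diff[of p q] by (auto simp: V_def)
    qed
  qed (use scale in \<open>auto simp: V_def\<close>)
  then obtain N where N: "\<And>n. n \<ge> N \<Longrightarrow> V n = V N" by blast
  have J_V: "J n = res ` V n" for n
  proof
    show "J n \<subseteq> res ` V n"
    proof
      fix u assume u: "u \<in> J n"
      have "ideal (J n) Q" using J by blast
      from ideal.Icarr[OF this u] have "u \<in> carrier Q" .
      then obtain p where p: "p \<in> carrier R" "u = res p" unfolding carrier_Q by blast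
      have u_eq: "u = res (basis_part p)" using p(2) res_basis_part[OF p(1)] by simp
      moreover have "basis_part p \<in> V n"
        using u unfolding u_eq V_def by (simp add: keys_basis_part)
      ultimately show "u \<in> res ` V n" by simp
    qed
  qed (auto simp: V_def)
  have "J n = J N" if "n \<ge> N" for n using N[OF that] J_V by simp
  then show "\<exists>N. \<forall>n\<ge>N. J n = J N" by blast
qed

lemma standard_graded_artinian_I: "standard_graded_artinian r I"
  unfolding standard_graded_artinian_def homogeneous_ideal_def
proof (intro conjI ballI allI)
  show "homogeneous_component d p \<in> I" if "p \<in> I" for p d
    using that keys_homogeneous_component[of d p] by (auto simp: mem_I_iff)
  show "I \<inter> forms r 1 \<subseteq> {0}"
  proof
    fix p assume p: "p \<in> I \<inter> forms r 1"
    have "mset_of_monomial m \<in> M 1" if "m \<in> Poly_Mapping.keys p" for m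
      using p that unfolding linear by (simp add: forms_iff)
    then have "Poly_Mapping.keys p \<subseteq> basis" using basis_degree by blast
    then show "p \<in> {0}" using p I_basis_zero by simp
  qed
qed (use r_pos ideal artinian_Q in auto)

lemma graded_piece_eq:
  "graded_piece r I d = res ` {p. Poly_Mapping.keys p \<subseteq> {m. mset_of_monomial m \<in> M d}}"
proof
  show "graded_piece r I d \<subseteq> res ` {p. Poly_Mapping.keys p \<subseteq> {m. mset_of_monomial m \<in> M d}}"
  proof
    fix u assume "u \<in> graded_piece r I d"
    then obtain p where p: "p \<in> forms r d" "u = res p" by (auto simp: graded_piece_def)
    have "Poly_Mapping.keys (basis_part p) \<subseteq> {m. mset_of_monomial m \<in> M d}"
      using p(1) basis_degree unfolding keys_basis_part forms_def by blast
    moreover have "u = res (basis_part p)" using p res_basis_part by (simp add: forms_def)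
    ultimately show "u \<in> res ` {p. Poly_Mapping.keys p \<subseteq> {m. mset_of_monomial m \<in> M d}}" by blast
  qed
  show "res ` {p. Poly_Mapping.keys p \<subseteq> {m. mset_of_monomial m \<in> M d}} \<subseteq> graded_piece r I d"
    unfolding graded_piece_def
  proof (rule image_mono)
    show "{p. Poly_Mapping.keys p \<subseteq> {m. mset_of_monomial m \<in> M d}} \<subseteq> forms r d"
      using M_subset[of d] by (fastforce simp: forms_iff)
  qed
qed

lemma dim_monomial_residues:
  assumes "X \<subseteq> M d"
  shows "ring.dim Q (scalars r I) (res ` {p. Poly_Mapping.keys p \<subseteq> {m. mset_of_monomial m \<in> X}}) = card X"
proof -
  have sub: "{m. mset_of_monomial m \<in> X} \<subseteq> basis" using assms basis_degree by blast
  have "ring.dim Q (scalars r I) (res ` {p. Poly_Mapping.keys p \<subseteq> {m. mset_of_monomial m \<in> X}}) =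
      card {m. mset_of_monomial m \<in> X}"
  proof (rule dim_residues)
    show "finite {m. mset_of_monomial m \<in> X}" using finite_subset[OF sub finite_basis] .
  qed (use sub basis_vars I_basis_zero in blast)+
  then show ?thesis using bij_betw_same_card[OF bij_betw_mset_of_monomial[of X]] by simp
qed

lemma h_vector_I: "h_vector r I d = card (M d)"
  unfolding h_vector_def graded_piece_eq by (rule dim_monomial_residues[OF order_refl])

text \<open>
  The annihilator of \<open>res p\<close> is an ideal, so it contains the maximal graded ideal as soon as it contains
  the classes of the variables.
\<close>

lemma socle_iff:
  assumes p: "p \<in> carrier R"
  shows "res p \<in> socle r I \<longleftrightarrow> (\<forall>j<r. var_poly j * p \<in> I)"
proof -
  interpret Q: cring Q by (rule cring_Q)
  let ?G = "(\<lambda>j. res (var_poly j)) ` {..<r}"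
  have mem: "res q \<in> carrier Q" if "q \<in> carrier R" for q using that unfolding carrier_Q by blast
  have G: "?G \<subseteq> carrier Q" using mem var_poly_carrier by blast
  have var: "res p \<otimes>\<^bsub>Q\<^esub> res (var_poly j) = \<zero>\<^bsub>Q\<^esub> \<longleftrightarrow> var_poly j * p \<in> I" if "j < r" for j
  proof -
    have "var_poly j * p \<in> carrier R"
      using cring.cring_simprules(5)[OF poly_ring_cring var_poly_carrier[OF that] p] by simp
    then show ?thesis
      using res_mult[OF p var_poly_carrier[OF that]] res_zero_iff by (simp add: mult.commute)
  qed
  define A where "A = {b \<in> carrier Q. res p \<otimes>\<^bsub>Q\<^esub> b = \<zero>\<^bsub>Q\<^esub>}"
  have "ideal A Q"
  proof (rule idealI[OF Q.ring_axioms])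
    show "subgroup A (add_monoid Q)"
    proof (rule Q.add.subgroupI)
      have "\<zero>\<^bsub>Q\<^esub> \<in> A" using mem[OF p] by (simp add: A_def)
      then show "A \<noteq> {}" by blast
    qed (use mem[OF p] in \<open>auto simp: A_def Q.r_minus Q.r_distr\<close>)
    fix a x assume a: "a \<in> A" "x \<in> carrier Q"
    then have "res p \<otimes>\<^bsub>Q\<^esub> (a \<otimes>\<^bsub>Q\<^esub> x) = \<zero>\<^bsub>Q\<^esub>"
      using mem[OF p] by (simp add: A_def flip: Q.m_assoc)
    then show "a \<otimes>\<^bsub>Q\<^esub> x \<in> A" "x \<otimes>\<^bsub>Q\<^esub> a \<in> A"
      using a by (simp_all add: A_def Q.m_comm)
  qed
  show ?thesis
  proof
    assume soc: "res p \<in> socle r I"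
    show "\<forall>j<r. var_poly j * p \<in> I"
    proof (intro allI impI)
      fix j assume j: "j < r"
      have "res (var_poly j) \<in> maximal_graded_ideal r I"
        unfolding maximal_graded_ideal_def using Q.genideal_self[OF G] j by blast
      then show "var_poly j * p \<in> I" using soc var[OF j] by (simp add: socle_def)
    qed
  next
    assume "\<forall>j<r. var_poly j * p \<in> I"
    then have "?G \<subseteq> A" using G var by (auto simp: A_def)
    then have "maximal_graded_ideal r I \<subseteq> A"
      unfolding maximal_graded_ideal_def by (rule Q.genideal_minimal[OF \<open>ideal A Q\<close>])
    then show "res p \<in> socle r I" using mem[OF p] by (auto simp: socle_def A_def)
  qed
qed

lemma var_times_mem_I:
  assumes "Poly_Mapping.keys p \<subseteq> {m. mset_of_monomial m \<in> M d}" "j < r"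
  shows "var_poly j * p \<in> I \<longleftrightarrow> (\<forall>m\<in>Poly_Mapping.keys p. add_mset j (mset_of_monomial m) \<notin> M (Suc d))"
proof -
  let ?e = "Poly_Mapping.single j (1 :: nat)"
  have e: "mset_of_monomial (?e + m) = add_mset j (mset_of_monomial m)" for m
    by (simp add: mset_of_monomial_add mset_of_monomial_var)
  have keys: "Poly_Mapping.keys (var_poly j * p) = (+) ?e ` Poly_Mapping.keys p"
    unfolding var_poly_def by (rule keys_monomial_times) simp
  have deg: "monomial_degree (?e + m) = Suc d" if "m \<in> Poly_Mapping.keys p" for m
  proof -
    have "mset_of_monomial m \<in> multisets_of_size {..<r} d" using that assms(1) M_subset by blast
    then have "size (mset_of_monomial m) = d" by (simp add: multisets_of_size_def)
    then show ?thesis unfolding size_mset_of_monomial[symmetric] e by simp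
  qed
  have "p \<in> carrier R" using assms(1) basis_degree basis_vars by fastforce
  then have "var_poly j * p \<in> carrier R"
    using cring.cring_simprules(5)[OF poly_ring_cring var_poly_carrier[OF assms(2)]] by simp
  then show ?thesis unfolding mem_I_iff keys using e deg by auto
qed

lemma socle_vector_I: "socle_vector r I d = card (M d - shadow (M (Suc d)))"
proof -
  let ?X = "{m. mset_of_monomial m \<in> M d - shadow (M (Suc d))}"
  have shadow_r: "mset_of_monomial m \<in> shadow (M (Suc d)) \<longleftrightarrow> (\<exists>j<r. add_mset j (mset_of_monomial m) \<in> M (Suc d))" for m
    using M_subset[of "Suc d"] by (fastforce simp: shadow_def multisets_of_size_def)
  have soc: "res p \<in> socle r I \<longleftrightarrow> Poly_Mapping.keys p \<subseteq> ?X"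
    if p: "Poly_Mapping.keys p \<subseteq> {m. mset_of_monomial m \<in> M d}" for p :: "'k mpolynomial"
  proof -
    have "p \<in> carrier R" using p basis_degree basis_vars by fastforce
    from socle_iff[OF this] show ?thesis using var_times_mem_I[OF p] p shadow_r by auto
  qed
  have "socle r I \<inter> graded_piece r I d = res ` {p. Poly_Mapping.keys p \<subseteq> ?X}"
    unfolding graded_piece_eq using soc by auto
  then show ?thesis unfolding socle_vector_def
    using dim_monomial_residues[of "M d - shadow (M (Suc d))" d] by simp
qed

end

section \<open>Two algebras with the same h-vector\<close>

lemma monomial_algebra:
  fixes h :: "nat \<Rightarrow> nat" and M :: "nat \<Rightarrow> nat multiset set"
  assumes "0 < r" "order_sequence r M" "\<And>d. card (M d) = h d" "h 1 = r" "\<forall>d>e. h d = 0"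
  defines "I \<equiv> monomial_ideal r M :: 'k::field mpolynomial set"
  shows "standard_graded_artinian r I" "h_vector r I = h"
    "socle_vector r I i = h i - card (shadow (M (Suc i)))"
proof -
  have sub: "M d \<subseteq> multisets_of_size {..<r} d" for d
    using assms(2) by (simp add: order_sequence_def)
  have fin: "finite (M d)" for d by (rule order_sequence_finite[OF assms(2)])
  interpret monomial_quotient r M I e
  proof (rule monomial_quotient.intro)
    have "card (M 1) = card (multisets_of_size {..<r} 1)"
      using assms(3)[of 1] assms(4) by (simp add: card_multisets_of_size)
    then show "M 1 = multisets_of_size {..<r} 1"
      using card_subset_eq[OF _ sub[of 1]] by (simp add: finite_multisets_of_size)
    show "M d = {}" if "e < d" for d using assms(3)[of d] assms(5) that fin[of d] by simp
  qed (use assms in simp_all)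
  show "standard_graded_artinian r I" by (rule standard_graded_artinian_I)
  show "h_vector r I = h" using h_vector_I assms(3) by auto
  show "socle_vector r I i = h i - card (shadow (M (Suc i)))"
    using socle_vector_I[of i] card_Diff_subset[OF finite_shadow[OF fin], of "Suc i" "M i"] assms(2,3)
    by (simp add: order_sequence_def)
qed

theorem theorem5p4:
  fixes h :: "nat \<Rightarrow> nat" and s :: "nat \<Rightarrow> int" and r e t :: nat
  assumes h_vec: "is_h_vector TYPE('k::field_char_0) h"
    and r: "r = h 1"
    and e: "1 \<le> e" "h e \<noteq> 0" "\<forall>i>e. h i = 0"
    and s_0: "s 0 = 0"
    and s_e: "s e = int (h e)"
    and s_mid: "\<forall>i\<in>{1..<e}. s i = int (h i) - int (lower_shift (h (i + 1)) (i + 1))"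
    and s_above: "\<forall>i>e. s i = 0"
    and t: "h t = (r - 1 + t) choose t" "\<forall>u>t. h u \<noteq> (r - 1 + u) choose u"
    and cond: "s (t + 1) * s (t + 2) \<noteq> 0
      \<or> (\<exists>i. s i * s (i + 1) \<noteq> 0
            \<and> lower_shift (h (i + 1) + 1) (i + 1) > lower_shift (h (i + 1)) (i + 1))
      \<or> s (e - 1) \<noteq> 0"
  shows "\<exists>(I :: 'k mpolynomial set) (J :: 'k mpolynomial set).
    standard_graded_artinian r I \<and> standard_graded_artinian r J \<and>
    h_vector r I = h \<and> h_vector r J = h \<and>
    socle_vector r I \<noteq> socle_vector r J"
proof -
  obtain r' and A :: "'k mpolynomial set" where A: "standard_graded_artinian r' A" "h_vector r' A = h"
    using h_vec unfolding is_h_vector_def by blast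
  have r': "r' = r" "0 < r" using h_vector_order_sequence(2,3)[OF A(1)] A(2) r by auto
  obtain B where B: "order_sequence r B" "\<And>d. card (B d) = h d"
    using h_vector_order_sequence(1)[OF A(1)] A(2) r' by auto
  obtain L M i where LM: "order_sequence r L" "order_sequence r M"
    "\<And>d. card (L d) = h d" "\<And>d. card (M d) = h d"
    "card (shadow (L (Suc i))) < card (shadow (M (Suc i)))"
    by (rule two_order_sequences[OF B r'(2) r[symmetric] e s_0 s_e s_mid s_above t cond]) blast
  let ?I = "monomial_ideal r L :: 'k mpolynomial set" and ?J = "monomial_ideal r M :: 'k mpolynomial set"
  note I = monomial_algebra[OF r'(2) LM(1,3) r[symmetric] e(3), where 'k = 'k]
  note J = monomial_algebra[OF r'(2) LM(2,4) r[symmetric] e(3), where 'k = 'k]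
  have "card (shadow (M (Suc i))) \<le> h i"
    using card_mono[OF order_sequence_finite[OF LM(2)], of "shadow (M (Suc i))" i] LM(2,4)
    by (simp add: order_sequence_def)
  then have "socle_vector r ?J i < socle_vector r ?I i"
    using LM(5) unfolding I(3) J(3) by linarith
  then have "socle_vector r ?I \<noteq> socle_vector r ?J" by auto
  then show ?thesis using I(1,2) J(1,2) by blast
qed

end
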